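(* Let $G$ be a connected graph of order $n\ge 2$ and let $\mathcal{H}=\{C_1,\dots,C_n\}$ be a family of $n$ cycles. If every cycle $C_i\in\mathcal{H}$ has order $n_i\ge 7$, then (i) $\dim_1(G\odot\mathcal{H})=\dim_1(G\odot\overline{\mathcal{H}})=\dim_1(G\odot(K_1\diamond\mathcal{H}))=\sum_{i=1}^{n}\left\lfloor\frac{2n_i+2}{5}\right\rfloor$. (ii) $\dim_2(G\odot\mathcal{H})=\dim_2(G\odot\overline{\mathcal{H}})=\dim_2(G\odot(K_1\diamond\mathcal{H}))=\sum_{i=1}^{n}\left\lceil\frac{n_i}{2}\right\rceil$. (iii) $\dim_3(G\odot\mathcal{H})=\dim_3(G\odot\overline{\mathcal{H}})=\dim_3(G\odot(K_1\diamond\mathcal{H}))=\sum_{i=1}^{n}\left(n_i-\left\lfloor\frac{n_i}{5}\right\rfloor\right)$. (iv) $\dim_4(G\odot\mathcal{H})=\dim_4(G\odot\overline{\mathcal{H}})=\dim_4(G\odot(K_1\diamond\mathcal{H}))=\sum_{i=1}^{n}n_i$.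
   Context: All graphs are finite, simple and undirected. $K_1+H$ is the join graph: $H$ together with one new vertex adjacent to every vertex of $H$. For a connected graph $\Gamma$, $d_\Gamma(x,y)$ is the length of a shortest path between $x$ and $y$. For a positive integer $k$, a set $S\subseteq V(\Gamma)$ is a $k$-metric generator for $\Gamma$ if for any two different vertices $u,v$ of $\Gamma$ there are at least $k$ vertices $w\in S$ with $d_\Gamma(u,w)\neq d_\Gamma(v,w)$. The minimum cardinality of a $k$-metric generator is the $k$-metric dimension $\dim_k(\Gamma)$; $\dim_1=\dim$ is the usual metric dimension. Corona product: if $G$ has vertices $v_1,\dots,v_n$ and $\mathcal{H}=\{H_1,\dots,H_n\}$ is a family of $n$ graphs (repetitions up to isomorphism allowed), $G\odot\mathcal{H}$ is obtained from the disjoint union of $G$ and $H_1,\dots,H_n$ by joining, for each $i$, the vertex $v_i$ by an edge to every vertex of $H_i$. $\overline{\mathcal{H}}=\{\overline{H}_1,\dots,\overline{H}_n\}$ is the family of the complement graphs, and $K_1\diamond\mathcal{H}=\{K_1+H_1,\dots,K_1+H_n\}$. *)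

theory Defs
  imports "Graph_Theory.Graph_Theory" "HOL-Library.Extended_Nat"
begin

text \<open>
  A finite simple undirected graph is a \<^locale>\<open>pair_graph\<close>: a finite, loop-free, symmetric
  digraph whose arcs are pairs of vertices.
\<close>

text \<open>With unit weights, the library's shortest-path cost is the usual graph distance.\<close>

definition graph_dist :: "'a pair_pre_digraph \<Rightarrow> 'a \<Rightarrow> 'a \<Rightarrow> ereal" where
  "graph_dist G u v = wf_digraph.\<mu> (with_proj G) (\<lambda>_. 1) u v"

definition kmetric_generator :: "nat \<Rightarrow> 'a pair_pre_digraph \<Rightarrow> 'a set \<Rightarrow> bool" where
  "kmetric_generator k G S \<longleftrightarrow> S \<subseteq> pverts G \<and>
     (\<forall>u \<in> pverts G. \<forall>v \<in> pverts G. u \<noteq> v \<longrightarrow>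
        k \<le> card {w \<in> S. graph_dist G u w \<noteq> graph_dist G v w})"

text \<open>
  The value is \<open>\<infinity>\<close> if there is no \<open>k\<close>-metric generator, so an equation with a natural number
  on the right-hand side also asserts that one exists.
\<close>

definition kmetric_dim :: "nat \<Rightarrow> 'a pair_pre_digraph \<Rightarrow> enat" where
  "kmetric_dim k G = (INF S \<in> {S. kmetric_generator k G S}. enat (card S))"

definition cycle_graph :: "nat \<Rightarrow> 'a pair_pre_digraph \<Rightarrow> bool" where
  "cycle_graph n C \<longleftrightarrow> 3 \<le> n \<and>
     (\<exists>f. bij_betw f {..<n} (pverts C) \<and>
        parcs C = {(f i, f j) | i j. i < n \<and> j < n \<and> (j = Suc i mod n \<or> i = Suc j mod n)})"

definition complement_graph :: "'a pair_pre_digraph \<Rightarrow> 'a pair_pre_digraph" where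
  "complement_graph G = \<lparr> pverts = pverts G,
     parcs = {(u, v). u \<in> pverts G \<and> v \<in> pverts G \<and> u \<noteq> v \<and> (u, v) \<notin> parcs G} \<rparr>"

text \<open>The join \<open>K\<^sub>1 + H\<close>; the new vertex is \<^const>\<open>None\<close>.\<close>

definition K1_join :: "'a pair_pre_digraph \<Rightarrow> 'a option pair_pre_digraph" where
  "K1_join H = \<lparr> pverts = insert None (Some ` pverts H),
     parcs = {(Some x, Some y) | x y. (x, y) \<in> parcs H}
       \<union> {(None, Some x) | x. x \<in> pverts H}
       \<union> {(Some x, None) | x. x \<in> pverts H} \<rparr>"

text \<open>
  The family is indexed by the vertices of \<open>G\<close>: the copy of \<open>H v\<close>, whose vertices are the
  \<open>Inr (v, x)\<close>, is attached to the vertex \<open>Inl v\<close>.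
\<close>

definition corona ::
  "'a pair_pre_digraph \<Rightarrow> ('a \<Rightarrow> 'b pair_pre_digraph) \<Rightarrow> ('a + 'a \<times> 'b) pair_pre_digraph" where
  "corona G H = \<lparr> pverts = Inl ` pverts G \<union> {Inr (v, x) | v x. v \<in> pverts G \<and> x \<in> pverts (H v)},
     parcs = {(Inl u, Inl v) | u v. (u, v) \<in> parcs G}
       \<union> {(Inr (v, x), Inr (v, y)) | v x y. v \<in> pverts G \<and> (x, y) \<in> parcs (H v)}
       \<union> {(Inl v, Inr (v, x)) | v x. v \<in> pverts G \<and> x \<in> pverts (H v)}
       \<union> {(Inr (v, x), Inl v) | v x. v \<in> pverts G \<and> x \<in> pverts (H v)} \<rparr>"

end

theory Submission
  imports Defs
begin

text \<open>
  The corona hides all of \<open>G\<close> from the copies. Two vertices of the same copy of \<open>H v\<close> are equally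
  far from everything outside it, and inside the copy their distances are truncated at 2, because
  the root is adjacent to the whole copy. So the part of a \<open>k\<close>-metric generator in each copy must
  be a \<open>k\<close>-adjacency generator of \<open>H v\<close>, a set that separates vertices by the truncated distance.
  Conversely, if \<open>G\<close> has at least two vertices, the union of \<open>k\<close>-adjacency generators with at least
  \<open>k\<close> elements each also separates all remaining pairs. The \<open>k\<close>-metric dimension of the corona is
  therefore the sum of the \<open>k\<close>-adjacency dimensions of the copies (\<open>kmetric_dim_corona\<close>). Complements
  have the same adjacency generators, and joining a vertex to a graph of maximum degree 2 does not
  change the dimension as soon as it is at least \<open>k + 2\<close>; this explains the equalities between the
  three coronas.

  For a cycle of length \<open>n\<close> at least 7, the vertices separating a pair form a window of four
  consecutive vertices, a window of five without its middle, or two disjoint closed neighbourhoods.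
  A generator becomes a 0-1 sequence of period \<open>n\<close> with at least \<open>k\<close> ones in each of these patterns
  (\<open>cyclic_generator\<close>). For \<open>k = 4\<close> all entries are one. The other lower bounds come from double
  counting windows. For \<open>k = 2\<close> a window of length four has at least two ones. For \<open>k = 3\<close> a window
  of length five has at least four ones. For \<open>k = 1\<close> it has at least two ones, up to a total defect
  of two caused by the only possible run of three zeros, whence \<open>2 n \<le> 5 s + 2\<close> for a generator of
  size \<open>s\<close>. Explicit periodic words attain these bounds (\<open>exists_generator_1\<close> to
  \<open>exists_generator_4\<close>).
\<close>

section \<open>Distances from height functions\<close>

text \<open>
  Distances in the corona are found by guessing a height function \<open>h\<close> towards the target: if an arc
  lowers \<open>h\<close> by at most one, no walk is shorter than \<open>h a\<close>; if some arc always lowers it by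
  exactly one, descending along such arcs gives a walk of that length.
\<close>

lemma graph_dist_eqI:
  fixes h :: "'v \<Rightarrow> nat"
  assumes wf: "pair_wf_digraph P"
    and verts: "a \<in> pverts P" "w \<in> pverts P"
    and zero: "h w = 0"
    and step: "\<And>a b. (a, b) \<in> parcs P \<Longrightarrow> h a \<le> Suc (h b)"
    and descent: "\<And>a. a \<in> pverts P \<Longrightarrow> a \<noteq> w \<Longrightarrow> \<exists>b. (a, b) \<in> parcs P \<and> h a = Suc (h b)"
  shows "graph_dist P a w = ereal (real (h a))"
proof -
  interpret pair_wf_digraph P by (rule wf)
  have cost: "awalk_cost (\<lambda>_. 1) p = real (length p)" for p
    by (induction p) auto
  have long: "awalk a p w \<Longrightarrow> h a \<le> length p" for a p
  proof (induction p arbitrary: a)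
    case Nil
    then show ?case using zero by (simp add: awalk_Nil_iff)
  next
    case (Cons e p)
    have "e \<in> parcs P" "fst e = a" "awalk (snd e) p w"
      using Cons.prems by (auto simp: awalk_Cons_iff)
    then show ?case using Cons.IH[of "snd e"] step[of a "snd e"] by force
  qed
  have short: "a \<in> pverts P \<Longrightarrow> h a = k \<Longrightarrow> \<exists>p. awalk a p w \<and> length p = k" for a k
  proof (induction k arbitrary: a)
    case 0
    then have "a = w" using descent by force
    then show ?case using 0 by (intro exI[of _ "[]"]) (simp add: awalk_Nil_iff)
  next
    case (Suc k)
    then have "a \<noteq> w" using zero by auto
    then obtain b where b: "(a, b) \<in> parcs P" "h b = k" using descent Suc.prems by fastforce
    then obtain p where "awalk b p w" "length p = k" using Suc.IH in_arcsD2 by blast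
    then show ?case using b by (intro exI[of _ "(a, b) # p"]) (auto simp: awalk_Cons_iff)
  qed
  obtain p where p: "awalk a p w" "length p = h a" using short verts(1) by blast
  show ?thesis unfolding graph_dist_def \<mu>_def
  proof (rule antisym)
    show "(INF p\<in>{p. awalk a p w}. ereal (awalk_cost (\<lambda>_. 1) p)) \<le> ereal (real (h a))"
      using p by (intro INF_lower2[of p]) (auto simp: cost)
    show "ereal (real (h a)) \<le> (INF p\<in>{p. awalk a p w}. ereal (awalk_cost (\<lambda>_. 1) p))"
      using long by (intro INF_greatest) (auto simp: cost)
  qed
qed

text \<open>
  Distances inside \<open>G\<close> enter only through the one-step equations below and through being positive
  between different vertices. A number of steps in the arc relation is enough for that.
\<close>

definition hops :: "'a pair_pre_digraph \<Rightarrow> 'a \<Rightarrow> 'a \<Rightarrow> nat" where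
  "hops G u w = (LEAST k. (u, w) \<in> parcs G ^^ k)"

lemma connected_imp_walk:
  assumes "pair_graph G" "Digraph_Component.connected (with_proj G)"
    and "u \<in> pverts G" "w \<in> pverts G"
  shows "\<exists>k. (u, w) \<in> parcs G ^^ k"
proof -
  interpret pair_graph G by (rule assms(1))
  have "u \<rightarrow>\<^sup>*\<^bsub>with_proj (mk_symmetric G)\<^esub> w"
    using assms(2-4) unfolding connected_def strongly_connected_def by simp
  then have "u \<rightarrow>\<^sup>*\<^bsub>with_proj G\<^esub> w"
    using reachable_mk_symmetric_eq pair_sym_arcs by simp
  then show ?thesis
    by (metis reachable_rtranclI rtrancl_imp_relpow with_proj_simps(3))
qed

lemma hops_step:
  assumes "(u, v) \<in> parcs G" "\<exists>k. (v, w) \<in> parcs G ^^ k"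
  shows "hops G u w \<le> Suc (hops G v w)"
proof -
  have "(v, w) \<in> parcs G ^^ hops G v w" unfolding hops_def using assms(2) by (rule LeastI_ex)
  then have "(u, w) \<in> parcs G ^^ Suc (hops G v w)" using assms(1) relpow_Suc_I2 by metis
  then show ?thesis unfolding hops_def by (rule Least_le)
qed

lemma hops_self [simp]: "hops G w w = 0"
  unfolding hops_def by (rule Least_eq_0) simp

lemma hops_descent:
  assumes "u \<noteq> w" "\<exists>k. (u, w) \<in> parcs G ^^ k"
  shows "\<exists>v. (u, v) \<in> parcs G \<and> hops G u w = Suc (hops G v w)"
proof -
  have walk: "(u, w) \<in> parcs G ^^ hops G u w"
    unfolding hops_def using assms(2) by (rule LeastI_ex)
  moreover have "hops G u w \<noteq> 0" using walk assms(1) by (metis relpow_0_E)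
  ultimately obtain k where k: "hops G u w = Suc k" "(u, w) \<in> parcs G ^^ Suc k"
    by (metis not0_implies_Suc)
  then obtain v where v: "(u, v) \<in> parcs G" "(v, w) \<in> parcs G ^^ k" by (meson relpow_Suc_E2)
  have "hops G v w \<le> k" unfolding hops_def using v(2) by (rule Least_le)
  moreover have "hops G u w \<le> Suc (hops G v w)" using v by (intro hops_step) auto
  ultimately show ?thesis using v(1) k(1) by force
qed

lemma hops_pos:
  assumes "u \<noteq> w" "\<exists>k. (u, w) \<in> parcs G ^^ k"
  shows "0 < hops G u w"
  using hops_descent[OF assms] by auto

section \<open>Adjacency generators and corona products\<close>

text \<open>
  This is the distance truncated at 2. Inside one copy of \<open>H v\<close> it is the distance of the corona,
  since two non-adjacent vertices of the copy are joined by a path through the root \<open>Inl v\<close>.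
\<close>

definition adj_dist :: "'b pair_pre_digraph \<Rightarrow> 'b \<Rightarrow> 'b \<Rightarrow> nat" where
  "adj_dist H x y = (if x = y then 0 else if (x, y) \<in> parcs H then 1 else 2)"

definition adjacency_generator :: "nat \<Rightarrow> 'b pair_pre_digraph \<Rightarrow> 'b set \<Rightarrow> bool" where
  "adjacency_generator k H S \<longleftrightarrow> S \<subseteq> pverts H \<and>
     (\<forall>x \<in> pverts H. \<forall>y \<in> pverts H. x \<noteq> y \<longrightarrow>
        k \<le> card {z \<in> S. adj_dist H x z \<noteq> adj_dist H y z})"

text \<open>
  A relation rather than a function, so that it also asserts that a generator exists.
\<close>

definition has_adjacency_dim :: "nat \<Rightarrow> 'b pair_pre_digraph \<Rightarrow> nat \<Rightarrow> bool" where
  "has_adjacency_dim k H m \<longleftrightarrow> (\<exists>S. adjacency_generator k H S \<and> card S = m) \<and>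
     (\<forall>S. adjacency_generator k H S \<longrightarrow> m \<le> card S)"

text \<open>
  A path leaves a copy of \<open>H v\<close> only through its root \<open>Inl v\<close>; this dictates all four cases.
\<close>

fun corona_dist ::
  "'a pair_pre_digraph \<Rightarrow> ('a \<Rightarrow> 'b pair_pre_digraph) \<Rightarrow> 'a + 'a \<times> 'b \<Rightarrow> 'a + 'a \<times> 'b \<Rightarrow> nat" where
  "corona_dist G H (Inl v) (Inl i) = hops G v i"
| "corona_dist G H (Inl v) (Inr (i, y)) = Suc (hops G v i)"
| "corona_dist G H (Inr (v, x)) (Inl i) = Suc (hops G v i)"
| "corona_dist G H (Inr (v, x)) (Inr (i, y)) =
     (if v = i then adj_dist (H v) x y else Suc (Suc (hops G v i)))"

locale corona_product =
  fixes G :: "'a pair_pre_digraph" and H :: "'a \<Rightarrow> 'b pair_pre_digraph"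
  assumes graph_G: "pair_graph G"
    and connected_G: "Digraph_Component.connected (with_proj G)"
    and wf_H: "\<And>v. v \<in> pverts G \<Longrightarrow> parcs (H v) \<subseteq> pverts (H v) \<times> pverts (H v)"
    and finite_H: "\<And>v. v \<in> pverts G \<Longrightarrow> finite (pverts (H v))"
begin

lemma finite_G: "finite (pverts G)"
proof -
  interpret G: pair_graph G by (rule graph_G)
  show ?thesis by (rule G.pair_finite_verts)
qed

lemma arc_in_G:
  assumes "(u, v) \<in> parcs G"
  shows "u \<in> pverts G \<and> v \<in> pverts G"
proof -
  interpret G: pair_graph G by (rule graph_G)
  show ?thesis using assms G.in_arcsD1 G.in_arcsD2 by simp
qed

lemma walk_in_G: "u \<in> pverts G \<Longrightarrow> w \<in> pverts G \<Longrightarrow> \<exists>k. (u, w) \<in> parcs G ^^ k"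
  by (rule connected_imp_walk[OF graph_G connected_G])

lemma arc_in_H:
  "v \<in> pverts G \<Longrightarrow> (x, y) \<in> parcs (H v) \<Longrightarrow> x \<in> pverts (H v) \<and> y \<in> pverts (H v)"
  using subsetD[OF wf_H, of v "(x, y)"] by simp

lemma wf_corona: "pair_wf_digraph (corona G H)"
proof
  fix e assume "e \<in> parcs (corona G H)"
  then consider u v where "e = (Inl u, Inl v)" "(u, v) \<in> parcs G"
    | v x y where "e = (Inr (v, x), Inr (v, y))" "v \<in> pverts G" "(x, y) \<in> parcs (H v)"
    | v x where "e = (Inl v, Inr (v, x))" "v \<in> pverts G" "x \<in> pverts (H v)"
    | v x where "e = (Inr (v, x), Inl v)" "v \<in> pverts G" "x \<in> pverts (H v)"
    unfolding corona_def by auto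
  then show "fst e \<in> pverts (corona G H)" "snd e \<in> pverts (corona G H)"
    by (cases; auto simp: corona_def dest: arc_in_G arc_in_H)+
qed

lemma finite_corona: "finite (pverts (corona G H))"
proof -
  have "pverts (corona G H) = Inl ` pverts G \<union> Inr ` (SIGMA v:pverts G. pverts (H v))"
    by (auto simp: corona_def)
  moreover have "finite (SIGMA v:pverts G. pverts (H v))"
    using finite_G finite_H by (rule finite_SigmaI)
  ultimately show ?thesis using finite_G by simp
qed

lemma graph_dist_corona:
  assumes "a \<in> pverts (corona G H)" "w \<in> pverts (corona G H)"
  shows "graph_dist (corona G H) a w = ereal (real (corona_dist G H a w))"
proof (rule graph_dist_eqI[OF wf_corona assms])
  show "corona_dist G H w w = 0" by (cases w) (auto simp: adj_dist_def)
next
  fix a b assume arc: "(a, b) \<in> parcs (corona G H)"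
  have G_step: "hops G u i \<le> Suc (hops G v i)" if "(u, v) \<in> parcs G" "i \<in> pverts G" for u v i
    using that arc_in_G walk_in_G by (intro hops_step) auto
  show "corona_dist G H a w \<le> Suc (corona_dist G H b w)"
  proof (cases w)
    case (Inl i)
    then show ?thesis using arc G_step assms(2) by (auto simp: corona_def)
  next
    case (Inr p)
    then show ?thesis using arc G_step assms(2) by (cases p) (auto simp: corona_def adj_dist_def)
  qed
next
  fix a assume a: "a \<in> pverts (corona G H)" "a \<noteq> w"
  have G_descent: "\<exists>v. (u, v) \<in> parcs G \<and> hops G u i = Suc (hops G v i)"
    if "u \<in> pverts G" "i \<in> pverts G" "u \<noteq> i" for u i
    using that walk_in_G by (intro hops_descent) auto
  show "\<exists>b. (a, b) \<in> parcs (corona G H) \<and> corona_dist G H a w = Suc (corona_dist G H b w)"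
  proof (cases a)
    case (Inl v)
    then have v: "v \<in> pverts G" using a by (auto simp: corona_def)
    show ?thesis
    proof (cases w)
      case w: (Inl i)
      then obtain u where "(v, u) \<in> parcs G" "hops G v i = Suc (hops G u i)"
        using G_descent[of v i] v Inl a assms(2) by (auto simp: corona_def)
      then show ?thesis using w Inl by (intro exI[of _ "Inl u"]) (auto simp: corona_def)
    next
      case w: (Inr p)
      then obtain i y where p: "p = (i, y)" "i \<in> pverts G" "y \<in> pverts (H i)"
        using assms(2) by (auto simp: corona_def)
      show ?thesis
      proof (cases "v = i")
        case True
        then show ?thesis using w Inl p v
          by (intro exI[of _ w]) (auto simp: corona_def adj_dist_def)
      next
        case False
        then obtain u where "(v, u) \<in> parcs G" "hops G v i = Suc (hops G u i)"
          using G_descent[of v i] v p by blast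
        then show ?thesis using w Inl p by (intro exI[of _ "Inl u"]) (auto simp: corona_def)
      qed
    qed
  next
    case (Inr q)
    then obtain v x where q: "q = (v, x)" "v \<in> pverts G" "x \<in> pverts (H v)"
      using a by (auto simp: corona_def)
    show ?thesis
    proof (cases "\<exists>y. w = Inr (v, y) \<and> (x, y) \<in> parcs (H v)")
      case True
      then obtain y where y: "w = Inr (v, y)" "(x, y) \<in> parcs (H v)" by blast
      then have "x \<noteq> y" using Inr q a(2) by auto
      then show ?thesis using Inr q y
        by (intro exI[of _ w]) (auto simp: corona_def adj_dist_def)
    next
      case False
      have "(a, Inl v) \<in> parcs (corona G H)" using Inr q by (auto simp: corona_def)
      moreover have "corona_dist G H a w = Suc (corona_dist G H (Inl v) w)"
      proof (cases w)
        case w: (Inr p)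
        obtain i y where p: "p = (i, y)" by fastforce
        show ?thesis
        proof (cases "i = v")
          case True
          then have "x \<noteq> y" "(x, y) \<notin> parcs (H v)" using False Inr q a(2) w p by auto
          then show ?thesis using True Inr q w p by (simp add: adj_dist_def)
        qed (use Inr q w p in simp)
      qed (use Inr q in simp)
      ultimately show ?thesis by blast
    qed
  qed
qed

lemma kmetric_generator_corona:
  "kmetric_generator k (corona G H) S \<longleftrightarrow> S \<subseteq> pverts (corona G H) \<and>
     (\<forall>u \<in> pverts (corona G H). \<forall>v \<in> pverts (corona G H). u \<noteq> v \<longrightarrow>
        k \<le> card {w \<in> S. corona_dist G H u w \<noteq> corona_dist G H v w})"
proof (cases "S \<subseteq> pverts (corona G H)")
  case True
  have "{w \<in> S. graph_dist (corona G H) u w \<noteq> graph_dist (corona G H) v w} =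
      {w \<in> S. corona_dist G H u w \<noteq> corona_dist G H v w}"
    if "u \<in> pverts (corona G H)" "v \<in> pverts (corona G H)" for u v
    using that True graph_dist_corona by auto
  then show ?thesis unfolding kmetric_generator_def by (intro conj_cong ball_cong refl) simp
qed (auto simp: kmetric_generator_def)

text \<open>
  All vertices outside the copy of \<open>H v\<close> see that copy through its root, hence at one common
  distance. So only the part of \<open>S\<close> inside the copy can separate two of its vertices.
\<close>

lemma adjacency_generator_fibre:
  assumes S: "kmetric_generator k (corona G H) S" and v: "v \<in> pverts G"
  shows "adjacency_generator k (H v) {x. Inr (v, x) \<in> S}"
proof -
  have sub: "S \<subseteq> pverts (corona G H)"
    and gen: "\<And>a b. a \<in> pverts (corona G H) \<Longrightarrow> b \<in> pverts (corona G H) \<Longrightarrow> a \<noteq> b \<Longrightarrow>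
      k \<le> card {w \<in> S. corona_dist G H a w \<noteq> corona_dist G H b w}"
    using S unfolding kmetric_generator_corona by blast+
  have "k \<le> card {z \<in> {x. Inr (v, x) \<in> S}. adj_dist (H v) x z \<noteq> adj_dist (H v) y z}"
    (is "k \<le> card ?Z")
    if "x \<in> pverts (H v)" "y \<in> pverts (H v)" "x \<noteq> y" for x y
  proof -
    have "{w \<in> S. corona_dist G H (Inr (v, x)) w \<noteq> corona_dist G H (Inr (v, y)) w} =
        (\<lambda>z. Inr (v, z)) ` ?Z" (is "?D = _")
    proof (rule set_eqI)
      fix w show "w \<in> ?D \<longleftrightarrow> w \<in> (\<lambda>z. Inr (v, z)) ` ?Z"
        by (cases w) (auto simp: image_iff split: if_splits)
    qed
    then have "card ?D = card ?Z" by (simp only:) (subst card_image, auto simp: inj_on_def)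
    moreover have "k \<le> card ?D" using that v by (intro gen) (auto simp: corona_def)
    ultimately show ?thesis by (simp only:)
  qed
  moreover have "{x. Inr (v, x) \<in> S} \<subseteq> pverts (H v)" using sub by (auto simp: corona_def)
  ultimately show ?thesis unfolding adjacency_generator_def by blast
qed

lemma card_fibres_le:
  assumes "S \<subseteq> pverts (corona G H)"
  shows "(\<Sum>v\<in>pverts G. card {x. Inr (v, x) \<in> S}) \<le> card S"
proof -
  have fin: "finite S" using assms finite_corona finite_subset by blast
  have sub: "{x. Inr (v, x) \<in> S} \<subseteq> pverts (H v)" for v
    using assms by (auto simp: corona_def)
  have "(\<Sum>v\<in>pverts G. card {x. Inr (v, x) \<in> S}) =
      card (SIGMA v:pverts G. {x. Inr (v, x) \<in> S})"
    using finite_G finite_H finite_subset[OF sub] by (subst card_SigmaI) auto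
  also have "\<dots> = card (Inr ` (SIGMA v:pverts G. {x. Inr (v, x) \<in> S}) :: ('a + 'a \<times> 'b) set)"
    by (subst card_image) auto
  also have "\<dots> \<le> card S" using fin by (intro card_mono) auto
  finally show ?thesis .
qed

text \<open>
  Two vertices of one copy are separated inside that copy. For every other pair some copy lies
  nearer to one of the two vertices than to the other as a whole; having two copies at all matters
  for a root against a leaf of its own copy.
\<close>

lemma kmetric_generator_union:
  assumes two: "2 \<le> card (pverts G)"
    and T: "\<And>v. v \<in> pverts G \<Longrightarrow> adjacency_generator k (H v) (T v)"
    and many: "\<And>v. v \<in> pverts G \<Longrightarrow> k \<le> card (T v)"
  shows "kmetric_generator k (corona G H) {Inr (v, x) | v x. v \<in> pverts G \<and> x \<in> T v}"
    (is "kmetric_generator _ _ ?S")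
proof -
  have T_sub: "T v \<subseteq> pverts (H v)" if "v \<in> pverts G" for v
    using T[OF that] by (simp add: adjacency_generator_def)
  have sub: "?S \<subseteq> pverts (corona G H)" using T_sub by (auto simp: corona_def)
  then have fin: "finite ?S" using finite_corona finite_subset by blast
  \<comment> \<open>Whenever one whole copy separates two vertices, its at least \<open>k\<close> chosen vertices suffice.\<close>
  have by_copy: "k \<le> card {w \<in> ?S. P w}"
    if "i \<in> pverts G" "\<And>x. P (Inr (i, x))" for i and P :: "'a + 'a \<times> 'b \<Rightarrow> bool"
  proof -
    have "k \<le> card (T i)" using many that(1) .
    also have "\<dots> = card ((\<lambda>x. Inr (i, x) :: 'a + 'a \<times> 'b) ` T i)"
      by (subst card_image) (auto simp: inj_on_def)
    also have "\<dots> \<le> card {w \<in> ?S. P w}" using that fin by (intro card_mono) auto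
    finally show ?thesis .
  qed
  have pos: "0 < hops G u i" if "u \<in> pverts G" "i \<in> pverts G" "u \<noteq> i" for u i
    using that walk_in_G by (intro hops_pos) auto
  let ?sep = "\<lambda>a b. k \<le> card {w \<in> ?S. corona_dist G H a w \<noteq> corona_dist G H b w}"
  have sep_sym: "?sep a b \<longleftrightarrow> ?sep b a" for a b by (simp add: eq_commute)
  have roots: "?sep (Inl v) (Inl u)" if "v \<in> pverts G" "u \<in> pverts G" "v \<noteq> u" for u v
    using that pos[of u v] by (intro by_copy[of v]) auto
  have mixed: "?sep (Inl v) (Inr (u, x))" if "v \<in> pverts G" "u \<in> pverts G" for u v x
  proof (cases "u = v")
    case True
    \<comment> \<open>A root and a leaf of its own copy are separated by every vertex of another copy.\<close>
    have "\<exists>j \<in> pverts G. j \<noteq> v"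
    proof (rule ccontr)
      assume "\<not> ?thesis"
      then have "card (pverts G) \<le> card {v}" by (intro card_mono) auto
      then show False using two by simp
    qed
    then obtain j where "j \<in> pverts G" "j \<noteq> v" by blast
    then show ?thesis using that True by (intro by_copy[of j]) auto
  next
    case False
    then show ?thesis using that by (intro by_copy[of v]) auto
  qed
  have leaves: "?sep (Inr (v, x)) (Inr (u, y))"
    if "v \<in> pverts G" "u \<in> pverts G" "x \<in> pverts (H v)" "y \<in> pverts (H u)" "(v, x) \<noteq> (u, y)"
    for u v x y
  proof (cases "u = v")
    case True
    have "k \<le> card {z \<in> T v. adj_dist (H v) x z \<noteq> adj_dist (H v) y z}" (is "k \<le> card ?Z")
      using T[OF that(1)] that True by (simp add: adjacency_generator_def)
    also have "\<dots> = card ((\<lambda>z. Inr (v, z) :: 'a + 'a \<times> 'b) ` ?Z)"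
      by (subst card_image) (auto simp: inj_on_def)
    also have "\<dots> \<le> card {w \<in> ?S. corona_dist G H (Inr (v, x)) w \<noteq> corona_dist G H (Inr (u, y)) w}"
      using that True fin by (intro card_mono) auto
    finally show ?thesis .
  next
    case False
    then show ?thesis using that pos[of u v] by (intro by_copy[of v]) (auto simp: adj_dist_def)
  qed
  have "?sep a b" if "a \<in> pverts (corona G H)" "b \<in> pverts (corona G H)" "a \<noteq> b" for a b
  proof -
    consider (ll) v u where "a = Inl v" "b = Inl u"
      | (lr) v u y where "a = Inl v" "b = Inr (u, y)"
      | (rl) v u x where "a = Inr (v, x)" "b = Inl u"
      | (rr) v u x y where "a = Inr (v, x)" "b = Inr (u, y)"
      by (cases a; cases b) auto
    then show ?thesis
    proof cases
      case ll then show ?thesis using roots that by (auto simp: corona_def)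
    next
      case lr then show ?thesis using mixed that by (auto simp: corona_def)
    next
      case rl then show ?thesis using mixed[of u v x] sep_sym[of a b] that by (auto simp: corona_def)
    next
      case rr then show ?thesis using leaves that by (auto simp: corona_def)
    qed
  qed
  then show ?thesis unfolding kmetric_generator_corona using sub by blast
qed

text \<open>
  The two preceding facts make the choice of a generator independent in each copy, so the minima
  add up.
\<close>

lemma kmetric_dim_corona:
  assumes two: "2 \<le> card (pverts G)"
    and dim: "\<And>v. v \<in> pverts G \<Longrightarrow> has_adjacency_dim k (H v) (m v)"
    and large: "\<And>v. v \<in> pverts G \<Longrightarrow> k \<le> m v"
  shows "kmetric_dim k (corona G H) = enat (\<Sum>v\<in>pverts G. m v)"
proof -
  have "\<forall>v \<in> pverts G. \<exists>S. adjacency_generator k (H v) S \<and> card S = m v"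
    using dim by (simp add: has_adjacency_dim_def)
  then obtain T where T: "\<And>v. v \<in> pverts G \<Longrightarrow> adjacency_generator k (H v) (T v)"
    and card_T: "\<And>v. v \<in> pverts G \<Longrightarrow> card (T v) = m v"
    by metis
  let ?S = "{Inr (v, x) | v x. v \<in> pverts G \<and> x \<in> T v} :: ('a + 'a \<times> 'b) set"
  have gen: "kmetric_generator k (corona G H) ?S"
    using two T card_T large by (intro kmetric_generator_union) auto
  have fin_T: "finite (T v)" if "v \<in> pverts G" for v
    using T[OF that] finite_H[OF that] finite_subset by (auto simp: adjacency_generator_def)
  have "?S = Inr ` (SIGMA v:pverts G. T v)" by auto
  then have "card ?S = card (SIGMA v:pverts G. T v)" by (simp add: card_image)
  also have "\<dots> = (\<Sum>v\<in>pverts G. m v)"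
    using finite_G fin_T card_T by (subst card_SigmaI) auto
  finally have card_S: "card ?S = (\<Sum>v\<in>pverts G. m v)" .
  have least: "(\<Sum>v\<in>pverts G. m v) \<le> card S" if S: "kmetric_generator k (corona G H) S" for S
  proof -
    have "(\<Sum>v\<in>pverts G. m v) \<le> (\<Sum>v\<in>pverts G. card {x. Inr (v, x) \<in> S})"
      using adjacency_generator_fibre[OF S] dim unfolding has_adjacency_dim_def
      by (intro sum_mono) blast
    also have "\<dots> \<le> card S" using S by (intro card_fibres_le) (simp add: kmetric_generator_def)
    finally show ?thesis .
  qed
  show ?thesis unfolding kmetric_dim_def
  proof (rule antisym)
    show "(INF S\<in>{S. kmetric_generator k (corona G H) S}. enat (card S)) \<le> enat (\<Sum>v\<in>pverts G. m v)"
    proof (rule INF_lower2)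
      show "?S \<in> {S. kmetric_generator k (corona G H) S}" using gen by blast
      show "enat (card ?S) \<le> enat (\<Sum>v\<in>pverts G. m v)" unfolding card_S by simp
    qed
    show "enat (\<Sum>v\<in>pverts G. m v) \<le> (INF S\<in>{S. kmetric_generator k (corona G H) S}. enat (card S))"
      using least by (intro INF_greatest) (simp only: mem_Collect_eq enat_ord_simps)
  qed
qed

end

section \<open>Complements and joins\<close>

text \<open>
  Complementing exchanges the values 1 and 2 of the truncated distance and keeps 0.
\<close>

lemma adjacency_generator_complement:
  "adjacency_generator k (complement_graph H) S \<longleftrightarrow> adjacency_generator k H S"
proof (cases "S \<subseteq> pverts H")
  case True
  have "adj_dist (complement_graph H) x z \<noteq> adj_dist (complement_graph H) y z \<longleftrightarrow>
      adj_dist H x z \<noteq> adj_dist H y z"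
    if "x \<in> pverts H" "y \<in> pverts H" "z \<in> pverts H" for x y z
    using that by (auto simp: adj_dist_def complement_graph_def)
  then have "{z \<in> S. adj_dist (complement_graph H) x z \<noteq> adj_dist (complement_graph H) y z} =
      {z \<in> S. adj_dist H x z \<noteq> adj_dist H y z}"
    if "x \<in> pverts H" "y \<in> pverts H" for x y
    using that True by blast
  then show ?thesis by (simp add: adjacency_generator_def complement_graph_def)
qed (simp add: adjacency_generator_def complement_graph_def)

lemma adj_dist_K1_join [simp]:
  "adj_dist (K1_join H) (Some x) (Some y) = adj_dist H x y"
  by (auto simp: adj_dist_def K1_join_def)

text \<open>
  The new vertex has truncated distance 1 to every old one, so it separates no two old vertices and
  any generator restricts to a generator of \<open>H\<close>. Conversely a minimal generator \<open>S\<close> of \<open>H\<close> only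
  has to separate the new vertex from an old vertex \<open>x\<close>. Every vertex of \<open>S\<close> outside the
  neighbourhood of \<open>x\<close> does this, and there are at least \<open>m - d\<close> of them.
\<close>

lemma has_adjacency_dim_K1_join:
  assumes fin: "finite (pverts H)"
    and deg: "\<And>x. x \<in> pverts H \<Longrightarrow> card {y. (x, y) \<in> parcs H} \<le> d"
    and fin_nbrs: "\<And>x. x \<in> pverts H \<Longrightarrow> finite {y. (x, y) \<in> parcs H}"
    and dim: "has_adjacency_dim k H m"
    and large: "k + d \<le> m"
  shows "has_adjacency_dim k (K1_join H) m"
proof -
  obtain S where S: "adjacency_generator k H S" "card S = m"
    using dim by (auto simp: has_adjacency_dim_def)
  have S_sub: "S \<subseteq> pverts H" using S(1) by (simp add: adjacency_generator_def)
  then have fin_S: "finite S" using fin finite_subset by blast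
  have cut: "{z \<in> Some ` A. P z} = Some ` {z \<in> A. P (Some z)}" for A :: "'a set" and P
    by auto
  let ?sep = "\<lambda>a b. k \<le> card {z \<in> Some ` S. adj_dist (K1_join H) a z \<noteq> adj_dist (K1_join H) b z}"
  have hub: "?sep None (Some x)" if "x \<in> pverts H" for x
  proof -
    have "k \<le> card S - card {y. (x, y) \<in> parcs H}" using S(2) deg[OF that] large by linarith
    also have "\<dots> \<le> card (S - {y. (x, y) \<in> parcs H})"
      by (rule diff_card_le_card_Diff[OF fin_nbrs[OF that]])
    also have "\<dots> \<le> card {z \<in> S. adj_dist (K1_join H) None (Some z) \<noteq> adj_dist H x z}"
      using fin_S S_sub by (intro card_mono) (auto simp: adj_dist_def K1_join_def)
    finally show ?thesis unfolding cut by (simp add: card_image)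
  qed
  have "?sep a b" if ab: "a \<in> pverts (K1_join H)" "b \<in> pverts (K1_join H)" "a \<noteq> b" for a b
  proof -
    have sym: "?sep a b \<longleftrightarrow> ?sep b a" by (simp add: eq_commute)
    show ?thesis
    proof (cases a)
      case None
      then show ?thesis using ab hub by (auto simp: K1_join_def)
    next
      case (Some x)
      show ?thesis
      proof (cases b)
        case None
        then show ?thesis using ab hub[of x] Some sym by (auto simp: K1_join_def)
      next
        case b: (Some y)
        have "x \<in> pverts H" "y \<in> pverts H" "x \<noteq> y" using ab Some b by (auto simp: K1_join_def)
        then have "k \<le> card {z \<in> S. adj_dist H x z \<noteq> adj_dist H y z}"
          using S(1) by (simp add: adjacency_generator_def)
        then show ?thesis unfolding cut Some b by (simp add: card_image)
      qed
    qed
  qed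
  moreover have "Some ` S \<subseteq> pverts (K1_join H)" using S_sub by (auto simp: K1_join_def)
  ultimately have gen: "adjacency_generator k (K1_join H) (Some ` S)"
    unfolding adjacency_generator_def by blast
  have least: "m \<le> card U" if U: "adjacency_generator k (K1_join H) U" for U
  proof -
    have U_sub: "U \<subseteq> pverts (K1_join H)" using U by (simp add: adjacency_generator_def)
    then have fin_U: "finite U" using fin finite_subset by (fastforce simp: K1_join_def)
    let ?V = "{z. Some z \<in> U}"
    have "k \<le> card {z \<in> ?V. adj_dist H x z \<noteq> adj_dist H y z}" (is "k \<le> card ?Z")
      if xy: "x \<in> pverts H" "y \<in> pverts H" "x \<noteq> y" for x y
    proof -
      have "{z \<in> U. adj_dist (K1_join H) (Some x) z \<noteq> adj_dist (K1_join H) (Some y) z} = Some ` ?Z"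
        (is "?D = _")
      proof (rule set_eqI)
        fix w show "w \<in> ?D \<longleftrightarrow> w \<in> Some ` ?Z"
          using xy by (cases w) (auto simp: adj_dist_def K1_join_def)
      qed
      moreover have "k \<le> card ?D"
        using U xy by (auto simp: adjacency_generator_def K1_join_def)
      ultimately show ?thesis by (simp add: card_image)
    qed
    moreover have "?V \<subseteq> pverts H" using U_sub by (auto simp: K1_join_def)
    ultimately have "adjacency_generator k H ?V" unfolding adjacency_generator_def by blast
    then have "m \<le> card ?V" using dim unfolding has_adjacency_dim_def by blast
    also have "card ?V = card (Some ` ?V)" by (simp add: card_image)
    also have "\<dots> \<le> card U" using fin_U by (intro card_mono) auto
    finally show ?thesis .
  qed
  have "card (Some ` S) = m" using S(2) by (simp add: card_image)
  then show ?thesis unfolding has_adjacency_dim_def using gen least by blast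
qed

section \<open>Lower bounds for periodic 0-1 sequences\<close>

text \<open>
  A subset of the cycle of length \<open>n\<close> is a 0-1 sequence of period \<open>n\<close>. The three families of sums
  count the elements separating two vertices at distance 1, at distance 2 (the common neighbour,
  at offset 2, does not separate them) and at distance at least 3 (two disjoint closed
  neighbourhoods).
\<close>

definition cyclic_generator :: "nat \<Rightarrow> nat \<Rightarrow> (int \<Rightarrow> nat) \<Rightarrow> bool" where
  "cyclic_generator k n b \<longleftrightarrow>
     (\<forall>i. b i \<le> 1) \<and> (\<forall>i. b (i + int n) = b i) \<and>
     (\<forall>i. k \<le> b i + b (i + 1) + b (i + 2) + b (i + 3)) \<and>
     (\<forall>i. k \<le> b i + b (i + 1) + b (i + 3) + b (i + 4)) \<and>
     (\<forall>i d. 3 \<le> d \<longrightarrow> d \<le> int n - 3 \<longrightarrow>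
        k \<le> b i + b (i + 1) + b (i + 2) + (b (i + d) + b (i + d + 1) + b (i + d + 2)))"

definition weight :: "nat \<Rightarrow> (int \<Rightarrow> nat) \<Rightarrow> nat" where
  "weight n b = (\<Sum>i\<in>{0..<int n}. b i)"

lemma weight_shift_one:
  assumes "\<And>i. f (i + int n) = f i"
  shows "weight n (\<lambda>i. f (i + 1)) = weight n f"
proof (cases "n = 0")
  case False
  have "weight n (\<lambda>i. f (i + 1)) = (\<Sum>i\<in>(\<lambda>i. i + 1) ` {0..<int n}. f i)"
    unfolding weight_def by (subst sum.reindex) auto
  also have "(\<lambda>i. i + 1) ` {0..<int n} = insert (int n) {1..<int n}"
    using False by auto
  also have "(\<Sum>i\<in>insert (int n) {1..<int n}. f i) = f (int n) + (\<Sum>i\<in>{1..<int n}. f i)"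
    by simp
  also have "\<dots> = f 0 + (\<Sum>i\<in>{1..<int n}. f i)" using assms[of 0] by simp
  also have "\<dots> = (\<Sum>i\<in>insert 0 {1..<int n}. f i)" by simp
  also have "insert 0 {1..<int n} = {0..<int n}" using False by auto
  finally show ?thesis by (simp add: weight_def)
qed (simp add: weight_def)

lemma weight_shift:
  assumes "\<And>i. f (i + int n) = f i"
  shows "weight n (\<lambda>i. f (i + int c)) = weight n f"
proof (induction c)
  case (Suc c)
  have "f (i + int n + int c) = f (i + int c)" for i using assms[of "i + int c"] by (simp add: ac_simps)
  then have "weight n (\<lambda>i. f (i + 1 + int c)) = weight n (\<lambda>i. f (i + int c))"
    by (rule weight_shift_one)
  then show ?case using Suc by (simp add: ac_simps)
qed simp

lemma weight_add: "weight n (\<lambda>i. f i + g i) = weight n f + weight n g"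
  by (simp add: weight_def sum.distrib)

lemma weight_const: "weight n (\<lambda>i. c) = n * c"
  by (simp add: weight_def)

lemma weight_mono: "(\<And>i. f i \<le> g i) \<Longrightarrow> weight n f \<le> weight n g"
  unfolding weight_def by (rule sum_mono)

text \<open>
  Double counting over all windows of length five: every position is counted five times.
\<close>

lemma weight_window:
  assumes "\<And>i. b (i + int n) = b i"
  shows "weight n (\<lambda>i. b i + b (i + 1) + b (i + 2) + b (i + 3) + b (i + 4)) = 5 * weight n b"
  using weight_shift[of b n 1, OF assms] weight_shift[of b n 2, OF assms]
    weight_shift[of b n 3, OF assms] weight_shift[of b n 4, OF assms]
  by (simp add: weight_add)

lemma weight_eq_card:
  assumes "\<And>i. b i \<le> 1"
  shows "weight n b = card {i \<in> {0..<int n}. b i = 1}"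
proof -
  have "b i = of_bool (b i = 1)" for i using assms[of i] by (cases "b i = 1") auto
  then have "weight n b = (\<Sum>i\<in>{0..<int n}. of_bool (b i = 1))"
    unfolding weight_def by (intro sum.cong refl) blast
  also have "\<dots> = card {i \<in> {0..<int n}. b i = 1}"
    by (simp add: of_bool_def flip: sum.inter_filter)
  finally show ?thesis .
qed

lemma generator_bit: "b i \<le> 1"
  and generator_period: "b (i + int n) = b i"
  and generator_window: "k \<le> b i + b (i + 1) + b (i + 2) + b (i + 3)"
  and generator_gapped: "k \<le> b i + b (i + 1) + b (i + 3) + b (i + 4)"
  and generator_far: "3 \<le> d \<Longrightarrow> d \<le> int n - 3 \<Longrightarrow>
     k \<le> b i + b (i + 1) + b (i + 2) + (b (i + d) + b (i + d + 1) + b (i + d + 2))"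
  if "cyclic_generator k n b"
  using that unfolding cyclic_generator_def by blast+

lemma weight_ge_4:
  assumes gen: "cyclic_generator 4 n b"
  shows "n \<le> weight n b"
proof -
  have "1 \<le> b i" for i using generator_window[OF gen, of i] generator_bit[OF gen, of i]
      generator_bit[OF gen, of "i + 1"] generator_bit[OF gen, of "i + 2"]
      generator_bit[OF gen, of "i + 3"]
    by linarith
  then have "weight n (\<lambda>i. 1) \<le> weight n b" by (rule weight_mono)
  then show ?thesis by (simp add: weight_const)
qed

text \<open>
  Any two zeros of a five-window either lie in one window of length four or are its two end points,
  where the gapped condition excludes them. So a five-window has at most one zero.
\<close>

lemma weight_ge_3:
  assumes gen: "cyclic_generator 3 n b"
  shows "4 * n \<le> 5 * weight n b"
proof -
  have "4 \<le> b i + b (i + 1) + b (i + 2) + b (i + 3) + b (i + 4)" for i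
    using generator_window[OF gen, of i] generator_window[OF gen, of "i + 1"]
        generator_gapped[OF gen, of i] generator_bit[OF gen, of i]
        generator_bit[OF gen, of "i + 1"] generator_bit[OF gen, of "i + 2"]
      generator_bit[OF gen, of "i + 3"] generator_bit[OF gen, of "i + 4"]
    by (simp add: add.assoc)
  then have "weight n (\<lambda>i. 4) \<le> weight n (\<lambda>i. b i + b (i + 1) + b (i + 2) + b (i + 3) + b (i + 4))"
    by (rule weight_mono)
  then show ?thesis by (simp add: weight_const weight_window[of b n, OF generator_period[OF gen]])
qed

lemma weight_ge_2:
  assumes gen: "cyclic_generator 2 n b"
  shows "n \<le> 2 * weight n b"
proof -
  have "weight n (\<lambda>i. 2) \<le> weight n (\<lambda>i. b i + b (i + 1) + b (i + 2) + b (i + 3))"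
    using generator_window[OF gen] by (intro weight_mono)
  also have "\<dots> = 4 * weight n b"
    using weight_shift[of b n 1, OF generator_period[OF gen]] weight_shift[of b n 2, OF generator_period[OF gen]]
      weight_shift[of b n 3, OF generator_period[OF gen]]
    by (simp add: weight_add)
  finally show ?thesis by (simp add: weight_const)
qed

text \<open>
  Up to the period, three consecutive zeros occur at most once: two such blocks overlap,
  giving four consecutive zeros, or else they are disjoint closed neighbourhoods.
\<close>

lemma unique_empty_neighbourhood:
  assumes gen: "cyclic_generator k n b" and pos: "0 < k"
    and i: "b i = 0" "b (i + 1) = 0" "b (i + 2) = 0"
    and j: "b j = 0" "b (j + 1) = 0" "b (j + 2) = 0"
    and ij: "i < j"
  shows "int n \<le> j - i"
proof (rule ccontr)
  assume "\<not> int n \<le> j - i"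
  then consider "j = i + 1" | "j = i + 2" | "3 \<le> j - i" "j - i \<le> int n - 3"
    | "i + int n = j + 1" | "i + int n = j + 2" using ij by linarith
  then show False
  proof cases
    case 1
    then show ?thesis using generator_window[OF gen, of i] i j pos by (simp add: add.assoc)
  next
    case 2
    then show ?thesis using generator_window[OF gen, of i] i j pos by (simp add: add.assoc)
  next
    case 3
    then show ?thesis using generator_far[OF gen, of "j - i" i] i j pos by (simp add: add.assoc)
  next
    case 4
    have "b (j + 3) = b (i + 2 + int n)" using 4 by (intro arg_cong[of _ _ b]) simp
    then show ?thesis using generator_window[OF gen, of j] i(3) j pos by (simp only: generator_period[OF gen])
  next
    case 5
    have "b (j + 3) = b (i + 1 + int n)" using 5 by (intro arg_cong[of _ _ b]) simp
    then show ?thesis using generator_window[OF gen, of j] i(2) j pos by (simp only: generator_period[OF gen])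
  qed
qed

text \<open>
  A window of length five contains two ones, except for \<open>01000\<close> and \<open>00010\<close>. Both contain three
  consecutive zeros, a block that is unique up to the period, so at most two windows miss one unit.
\<close>

lemma weight_ge_1:
  assumes gen: "cyclic_generator 1 n b"
  shows "2 * n \<le> 5 * weight n b + 2"
proof -
  \<comment> \<open>\<open>e\<close> marks the starts of the blocks \<open>000\<close>; a deficient five-window has one at offset 0 or 2.\<close>
  define e where "e i = (if b i + b (i + 1) + b (i + 2) = 0 then 1 else 0 :: nat)" for i
  have e_period: "e (i + int n) = e i" for i
  proof -
    have "b (i + int n + 1) = b (i + 1)" "b (i + int n + 2) = b (i + 2)"
      using generator_period[OF gen, of "i + 1"] generator_period[OF gen, of "i + 2"]
          by (simp_all add: add.commute add.left_commute)
    then show ?thesis by (simp only: e_def generator_period[OF gen])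
  qed
  have "2 \<le> b i + b (i + 1) + b (i + 2) + b (i + 3) + b (i + 4) + (e i + e (i + 2))" for i
  proof -
    have *: "i + 1 + 1 = i + 2" "i + 1 + 2 = i + 3" "i + 1 + 3 = i + 4" "i + 2 + 1 = i + 3"
      "i + 2 + 2 = i + 4" by simp_all
    have "b i + b (i + 1) + b (i + 2) = 0 \<Longrightarrow> e i = 1"
      and "b (i + 2) + b (i + 3) + b (i + 4) = 0 \<Longrightarrow> e (i + 2) = 1"
      unfolding e_def * by simp_all
    then show ?thesis
      using generator_window[OF gen, of i] generator_window[OF gen, of "i + 1"]
          generator_gapped[OF gen, of i] unfolding * by linarith
  qed
  then have "weight n (\<lambda>i. 2) \<le>
      weight n (\<lambda>i. b i + b (i + 1) + b (i + 2) + b (i + 3) + b (i + 4) + (e i + e (i + 2)))"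
    by (rule weight_mono)
  also have "\<dots> = 5 * weight n b + weight n (\<lambda>i. e i + e (i + 2))"
    unfolding weight_window[of b n, OF generator_period[OF gen], symmetric] by (rule weight_add)
  also have "weight n (\<lambda>i. e i + e (i + 2)) = weight n e + weight n (\<lambda>i. e (i + 2))"
    by (rule weight_add)
  also have "weight n (\<lambda>i. e (i + 2)) = weight n e"
    using weight_shift[of e n 2, OF e_period] by simp
  finally have main: "2 * n \<le> 5 * weight n b + 2 * weight n e"
    unfolding weight_const by simp
  define Z where "Z = {i \<in> {0..<int n}. e i = 1}"
  have "weight n e = card Z" unfolding Z_def by (rule weight_eq_card) (simp add: e_def)
  also have "\<dots> \<le> Suc 0"
  proof -
    have ordered: "\<not> i < j" if "i \<in> Z" "j \<in> Z" for i j
    proof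
      assume "i < j"
      have zero: "b l = 0" "b (l + 1) = 0" "b (l + 2) = 0" if "l \<in> Z" for l
        using that unfolding Z_def e_def by (auto split: if_splits)
      have "int n \<le> j - i"
        using zero[OF \<open>i \<in> Z\<close>] zero[OF \<open>j \<in> Z\<close>] \<open>i < j\<close>
        by (intro unique_empty_neighbourhood[OF gen]) simp_all
      then show False using that unfolding Z_def by simp
    qed
    have "i = j" if "i \<in> Z" "j \<in> Z" for i j
      using ordered[OF that] ordered[OF that(2,1)] by simp
    moreover have "finite Z" unfolding Z_def by (rule finite_Collect_conjI) simp
    ultimately show ?thesis by (simp add: card_le_Suc0_iff_eq)
  qed
  finally show ?thesis using main by linarith
qed

section \<open>Extremal periodic words\<close>

definition cyclic_word :: "nat \<Rightarrow> (int \<Rightarrow> bool) \<Rightarrow> int \<Rightarrow> nat" where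
  "cyclic_word n P i = of_bool (P (i mod int n))"

lemma cyclic_word_bit [simp]: "cyclic_word n P i \<le> Suc 0"
  by (simp add: cyclic_word_def)

lemma cyclic_word_period [simp]: "cyclic_word n P (i + int n) = cyclic_word n P i"
  by (simp add: cyclic_word_def)

lemma cyclic_word_eq_0 [simp]: "cyclic_word n P i = 0 \<longleftrightarrow> \<not> P (i mod int n)"
  by (simp add: cyclic_word_def)

lemma weight_cyclic_word: "weight n (cyclic_word n P) = card {i \<in> {0..<int n}. P i}"
  by (subst weight_eq_card) (auto simp: cyclic_word_def intro!: arg_cong[of _ _ card])

lemma mod_add_cases:
  fixes n :: int
  assumes "0 \<le> d" "d < n"
  shows "(i + d) mod n = (if i mod n + d < n then i mod n + d else i mod n + d - n)"
proof -
  have r: "0 \<le> i mod n" "i mod n < n" using assms by auto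
  have "(i + d) mod n = (i mod n + d) mod n" by (simp add: mod_simps)
  also have "\<dots> = (if i mod n + d < n then i mod n + d else i mod n + d - n)"
  proof (cases "i mod n + d < n")
    case False
    have "(i mod n + d) mod n = (i mod n + d - n) mod n" by (rule minus_mod_self2[symmetric])
    also have "\<dots> = i mod n + d - n" using False r assms by (intro mod_pos_pos_trivial) linarith+
    finally show ?thesis using False by simp
  qed (use r assms in simp)
  finally show ?thesis .
qed

lemma exists_generator_4:
  "\<exists>b. cyclic_generator 4 n b \<and> weight n b = n"
  by (rule exI[of _ "\<lambda>_. 1"]) (simp add: cyclic_generator_def weight_const)

text \<open>
  Zeros at the multiples of 5, stopping early enough that the last one is also at distance at least
  5 from the first one around the cycle.
\<close>

lemma exists_generator_3:
  assumes n: "7 \<le> n"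
  shows "\<exists>b. cyclic_generator 3 n b \<and> weight n b = n - n div 5"
proof -
  define Q where "Q r \<longleftrightarrow> r mod 5 = 0 \<and> r + 5 \<le> int n" for r :: int
  define b where "b = cyclic_word n (\<lambda>r. \<not> Q r)"
  have sparse: "1 \<le> b i + b (i + d)" if "1 \<le> d" "d \<le> 4" for i d
  proof (rule ccontr)
    assume "\<not> ?thesis"
    then have "b i = 0" "b (i + d) = 0" by auto
    then have "Q (i mod int n)" "Q ((i + d) mod int n)" by (simp_all add: b_def)
    moreover define r where "r = i mod int n"
    ultimately have "Q r" "Q (if r + d < int n then r + d else r + d - int n)"
      using that n by (auto simp: mod_add_cases)
    then have "r + d < int n" "5 dvd r" "5 dvd r + d"
      using that by (auto simp: Q_def split: if_splits)
    then have "5 dvd d" by (simp add: dvd_add_right_iff)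
    then show False using that zdvd_imp_le by fastforce
  qed
  have "cyclic_generator 3 n b" unfolding cyclic_generator_def
  proof (intro conjI allI impI)
    fix i d
    note z = sparse[of 1 i] sparse[of 2 i] sparse[of 3 i] sparse[of 4 i] sparse[of 1 "i + 1"]
      sparse[of 2 "i + 1"] sparse[of 3 "i + 1"] sparse[of 1 "i + 2"] sparse[of 1 "i + 3"]
    show "3 \<le> b i + b (i + 1) + b (i + 2) + b (i + 3)"
      using z by (cases "b i = 0"; cases "b (i + 1) = 0"; cases "b (i + 2) = 0"; simp add: add.assoc)
    show "3 \<le> b i + b (i + 1) + b (i + 3) + b (i + 4)"
      using z by (cases "b i = 0"; cases "b (i + 1) = 0"; cases "b (i + 3) = 0"; simp add: add.assoc)
    show "3 \<le> b i + b (i + 1) + b (i + 2) + (b (i + d) + b (i + d + 1) + b (i + d + 2))"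
      using z(1,2,5) sparse[of 1 "i + d"] sparse[of 2 "i + d"] sparse[of 1 "i + d + 1"]
      by (cases "b i = 0"; cases "b (i + 1) = 0"; simp add: add.assoc)
  qed (simp_all add: b_def)
  moreover have "weight n b = n - n div 5"
  proof -
    have "{r \<in> {0..<int n}. \<not> Q r} = {0..<int n} - (\<lambda>j. 5 * int j) ` {..<n div 5}"
    proof -
      have "{r \<in> {0..<int n}. Q r} = (\<lambda>j. 5 * int j) ` {..<n div 5}"
      proof (intro set_eqI iffI)
        fix r assume "r \<in> {r \<in> {0..<int n}. Q r}"
        then have "r = 5 * int (nat (r div 5))" "nat (r div 5) < n div 5" by (auto simp: Q_def)
        then show "r \<in> (\<lambda>j. 5 * int j) ` {..<n div 5}" by blast
      qed (auto simp: Q_def)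
      then show ?thesis by auto
    qed
    moreover have "(\<lambda>j. 5 * int j) ` {..<n div 5} \<subseteq> {0..<int n}" by auto
    moreover have "card ((\<lambda>j. 5 * int j) ` {..<n div 5}) = n div 5"
      by (subst card_image) (auto simp: inj_on_def)
    ultimately show ?thesis by (simp add: b_def weight_cyclic_word card_Diff_subset)
  qed
  ultimately show ?thesis by blast
qed

text \<open>
  Without two consecutive zeros every pair of neighbouring positions contributes a one, which gives
  all three conditions. When \<open>n\<close> is odd, the positions \<open>n - 1\<close> and \<open>0\<close> are both ones.
\<close>

lemma exists_generator_2:
  assumes n: "7 \<le> n"
  shows "\<exists>b. cyclic_generator 2 n b \<and> weight n b = (n + 1) div 2"
proof -
  define b where "b = cyclic_word n even"
  have sparse: "1 \<le> b i + b (i + 1)" for i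
  proof (rule ccontr)
    assume "\<not> ?thesis"
    then have "b i = 0" "b (i + 1) = 0" by auto
    then have "odd (i mod int n)" "odd ((i + 1) mod int n)" by (simp_all add: b_def)
    moreover define r where "r = i mod int n"
    ultimately have "odd r" "odd (if r + 1 < int n then r + 1 else r + 1 - int n)"
      using n by (auto simp: mod_add_cases)
    moreover have "r < int n" using n by (simp add: r_def)
    ultimately show False by (auto split: if_splits; presburger)
  qed
  have "cyclic_generator 2 n b" unfolding cyclic_generator_def
  proof (intro conjI allI impI)
    fix i d
    show "2 \<le> b i + b (i + 1) + b (i + 2) + b (i + 3)"
      using sparse[of i] sparse[of "i + 2"] by (simp add: add.assoc)
    show "2 \<le> b i + b (i + 1) + b (i + 3) + b (i + 4)"
      using sparse[of i] sparse[of "i + 3"] by (simp add: add.assoc)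
    show "2 \<le> b i + b (i + 1) + b (i + 2) + (b (i + d) + b (i + d + 1) + b (i + d + 2))"
      using sparse[of i] sparse[of "i + d"] by (simp add: add.assoc)
  qed (simp_all add: b_def)
  moreover have "weight n b = (n + 1) div 2"
  proof -
    have "{r \<in> {0..<int n}. even r} = (\<lambda>j. 2 * int j) ` {..<(n + 1) div 2}"
    proof (intro set_eqI iffI)
      fix r assume "r \<in> {r \<in> {0..<int n}. even r}"
      then have "r = 2 * int (nat (r div 2))" "nat (r div 2) < (n + 1) div 2" by auto
      then show "r \<in> (\<lambda>j. 2 * int j) ` {..<(n + 1) div 2}" by blast
    qed auto
    then have "weight n b = card ((\<lambda>j. 2 * int j) ` {..<(n + 1) div 2})"
      by (simp add: b_def weight_cyclic_word)
    then show ?thesis by (subst (asm) card_image) (auto simp: inj_on_def)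
  qed
  ultimately show ?thesis by blast
qed

lemma card_blocks:
  "card {r \<in> {0..<5 * int q}. r mod 5 = 0 \<or> r mod 5 = 2} = 2 * q"
proof (induction q)
  case (Suc q)
  have "{r \<in> {0..<5 * int (Suc q)}. r mod 5 = 0 \<or> r mod 5 = 2} =
      insert (5 * int q) (insert (5 * int q + 2) {r \<in> {0..<5 * int q}. r mod 5 = 0 \<or> r mod 5 = 2})"
    by (auto; presburger)
  moreover have "finite {r \<in> {0..<5 * int q}. r mod 5 = 0 \<or> r mod 5 = 2}"
    by (rule finite_subset[of _ "{0..<5 * int q}"]) auto
  ultimately have "card {r \<in> {0..<5 * int (Suc q)}. r mod 5 = 0 \<or> r mod 5 = 2} =
      Suc (Suc (card {r \<in> {0..<5 * int q}. r mod 5 = 0 \<or> r mod 5 = 2}))"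
    by (simp only: card_insert_if) auto
  then show ?case using Suc by simp
qed simp

text \<open>
  The blocks \<open>10100\<close> leave gaps of sizes 1 and 2 in turn, which meets the bound of two ones per
  five-window. The remaining \<open>n mod 5\<close> positions are filled by the tail of the word \<open>1010\<close>. For an
  odd remainder this tail begins with a zero and produces the one permitted gap of size 3.
\<close>

lemma exists_generator_1:
  assumes n: "7 \<le> n"
  shows "\<exists>b. cyclic_generator 1 n b \<and> weight n b = (2 * n + 2) div 5"
proof -
  define q where "q = int n div 5"
  have q: "5 * q \<le> int n" "int n < 5 * q + 5" "1 \<le> q" using n by (auto simp: q_def)
  define Q where "Q r \<longleftrightarrow> (if r < 5 * q then r mod 5 = 0 \<or> r mod 5 = 2 else even (int n - r))"
    for r :: int
  define b where "b = cyclic_word n Q"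
  \<comment> \<open>Two consecutive zeros occur only as the end of a block or where the last block meets the tail.\<close>
  have pair: "i mod int n mod 5 = 3 \<and> i mod int n < 5 * q \<or> i mod int n = 5 * q - 1"
    if "b i + b (i + 1) = 0" for i
  proof -
    define r where "r = i mod int n"
    have r: "0 \<le> r" "r < int n" using n by (auto simp: r_def)
    have "(i + 1) mod int n = (if r + 1 < int n then r + 1 else r + 1 - int n)"
      unfolding r_def using n by (intro mod_add_cases) auto
    then have Q: "\<not> Q r" "\<not> Q (if r + 1 < int n then r + 1 else r + 1 - int n)"
      using that by (simp_all add: b_def r_def)
    consider "r + 1 < 5 * q" | "r + 1 = 5 * q" | "5 * q \<le> r" "r + 1 < int n" | "r + 1 = int n"
      using r by linarith
    then have "r mod 5 = 3 \<and> r < 5 * q \<or> r = 5 * q - 1"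
    proof cases
      case 1
      then have "r mod 5 \<noteq> 0" "r mod 5 \<noteq> 2" "(r + 1) mod 5 \<noteq> 0" "(r + 1) mod 5 \<noteq> 2"
        using Q q by (simp_all add: Q_def)
      then have "r mod 5 = 3" by presburger
      then show ?thesis using 1 by simp
    next
      case 3
      then have "odd (int n - r)" "odd (int n - (r + 1))" using Q by (simp_all add: Q_def)
      then show ?thesis by simp
    next
      case 4
      then show ?thesis using Q(2) q(3) by (simp add: Q_def)
    qed simp
    then show ?thesis by (simp add: r_def)
  qed
  \<comment> \<open>Two pairs of zeros cannot start at distance 2 or 3: no \<open>0000\<close> and no \<open>00x00\<close>.\<close>
  have no_two: "b i + b (i + 1) + b (i + d) + b (i + d + 1) \<noteq> 0" if d: "d = 2 \<or> d = 3" for i d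
  proof
    assume zero: "b i + b (i + 1) + b (i + d) + b (i + d + 1) = 0"
    define r where "r = i mod int n"
    have r: "0 \<le> r" "r < int n" using n by (auto simp: r_def)
    have 1: "r mod 5 = 3 \<and> r < 5 * q \<or> r = 5 * q - 1"
      using pair[of i] zero by (simp add: r_def)
    define s where "s = (i + d) mod int n"
    have s: "s = (if r + d < int n then r + d else r + d - int n)"
      unfolding s_def r_def using d n by (intro mod_add_cases) auto
    have 2: "s mod 5 = 3 \<and> s < 5 * q \<or> s = 5 * q - 1"
      using pair[of "i + d"] zero by (simp add: s_def)
    show False
    proof (cases "r + d < int n")
      case True
      then have "s = r + d" using s by simp
      then show False using 1 2 d by (elim disjE conjE) presburger+
    next
      case False
      then have "s < 3" "s \<ge> 0" using s r d by auto
      then show False using 2 q(3) by auto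
    qed
  qed
  have triple: "i mod int n = 5 * q - 2" if zero: "b i + b (i + 1) + b (i + 2) = 0" for i
  proof -
    define r where "r = i mod int n"
    have r: "0 \<le> r" "r < int n" using n by (auto simp: r_def)
    have 1: "r mod 5 = 3 \<and> r < 5 * q \<or> r = 5 * q - 1"
      using pair[of i] zero by (simp add: r_def)
    define s where "s = (i + 1) mod int n"
    have s: "s = (if r + 1 < int n then r + 1 else r + 1 - int n)"
      unfolding s_def r_def using n by (intro mod_add_cases) auto
    have 2: "s mod 5 = 3 \<and> s < 5 * q \<or> s = 5 * q - 1"
      using pair[of "i + 1"] zero by (simp add: s_def add.assoc)
    have "r = 5 * q - 2"
    proof (cases "r + 1 < int n")
      case True
      then have "s = r + 1" using s by simp
      then show ?thesis using 1 2 by (elim disjE conjE) presburger+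
    next
      case False
      then have "s = 0" using s r by auto
      then show ?thesis using 2 q(3) by auto
    qed
    then show ?thesis by (simp add: r_def)
  qed
  have "cyclic_generator 1 n b" unfolding cyclic_generator_def
  proof (intro conjI allI impI)
    fix i
    show "1 \<le> b i + b (i + 1) + b (i + 2) + b (i + 3)"
      using no_two[of 2 i] by (auto simp: add.assoc)
    show "1 \<le> b i + b (i + 1) + b (i + 3) + b (i + 4)"
      using no_two[of 3 i] by (auto simp: add.assoc)
    fix d :: int assume d: "3 \<le> d" "d \<le> int n - 3"
    show "1 \<le> b i + b (i + 1) + b (i + 2) + (b (i + d) + b (i + d + 1) + b (i + d + 2))"
    proof (rule ccontr)
      assume "\<not> ?thesis"
      then have "i mod int n = (i + d) mod int n" using triple[of i] triple[of "i + d"] by simp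
      then show False using d n mod_add_cases[of d "int n" i] by (auto split: if_splits)
    qed
  qed (simp_all add: b_def)
  moreover have "weight n b = (2 * n + 2) div 5"
  proof -
    define L where "L = n mod 5"
    have L: "int n = 5 * q + int L" "L < 5" by (auto simp: L_def q_def zdiv_int zmod_int)
    have "{r \<in> {0..<int n}. Q r} =
        {r \<in> {0..<5 * q}. r mod 5 = 0 \<or> r mod 5 = 2} \<union> {r \<in> {5 * q..<int n}. even (int n - r)}"
      using q by (auto simp: Q_def)
    moreover have "card {r \<in> {0..<5 * q}. r mod 5 = 0 \<or> r mod 5 = 2} = 2 * nat q"
      using card_blocks[of "nat q"] q by simp
    moreover have "card {r \<in> {5 * q..<int n}. even (int n - r)} = L div 2"
    proof -
      have "{r \<in> {5 * q..<int n}. even (int n - r)} = (\<lambda>j. int n - 2 * int j) ` {1..L div 2}"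
      proof (intro set_eqI iffI)
        fix r assume r: "r \<in> {r \<in> {5 * q..<int n}. even (int n - r)}"
        then have "even (int n - r)" by blast
        then obtain m where m: "int n - r = 2 * m" by (rule evenE)
        then have "r = int n - 2 * int (nat m)" "nat m \<in> {1..L div 2}" using r L by auto
        then show "r \<in> (\<lambda>j. int n - 2 * int j) ` {1..L div 2}" by blast
      qed (use L in auto)
      moreover have "inj_on (\<lambda>j. int n - 2 * int j) {1..L div 2}" by (auto simp: inj_on_def)
      ultimately show ?thesis by (simp add: card_image)
    qed
    moreover have "card ({r \<in> {0..<5 * q}. r mod 5 = 0 \<or> r mod 5 = 2} \<union>
          {r \<in> {5 * q..<int n}. even (int n - r)}) =
        card {r \<in> {0..<5 * q}. r mod 5 = 0 \<or> r mod 5 = 2} +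
        card {r \<in> {5 * q..<int n}. even (int n - r)}"
      by (rule card_Un_disjoint; (rule finite_subset[of _ "{0..<int n}"])?) (use q in auto)
    ultimately have "weight n b = 2 * nat q + L div 2"
      unfolding b_def weight_cyclic_word by (simp only:)
    moreover have "n = 5 * nat q + L" using L q by linarith
    moreover have "(10 * nat q + 2 * L + 2) div 5 = 2 * nat q + L div 2"
    proof -
      consider "L = 0" | "L = 1" | "L = 2" | "L = 3" | "L = 4" using L(2) by linarith
      then show ?thesis by cases simp_all
    qed
    ultimately show ?thesis by simp
  qed
  ultimately show ?thesis by blast
qed

section \<open>Adjacency dimensions of cycles\<close>

text \<open>
  Labelling the cycle by all integers modulo \<open>n\<close> lets a pair of vertices be written as \<open>g i\<close> and
  \<open>g (i + d)\<close> without case distinctions for wrapping around.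
\<close>

locale cyclic_labelling =
  fixes C :: "'b pair_pre_digraph" and n :: nat and g :: "int \<Rightarrow> 'b"
  assumes long: "7 \<le> n"
    and same: "g i = g j \<longleftrightarrow> (j - i) mod int n = 0"
    and range_g: "range g = pverts C"
    and arc_ends: "parcs C \<subseteq> pverts C \<times> pverts C"
    and arc: "(g i, g j) \<in> parcs C \<longleftrightarrow> (j - i) mod int n = 1 \<or> (i - j) mod int n = 1"

lemma cycle_graph_labelling:
  assumes "cycle_graph n C" "7 \<le> n"
  obtains g where "cyclic_labelling C n g"
proof -
  obtain f where f: "bij_betw f {..<n} (pverts C)"
    and arcs: "parcs C = {(f i, f j) | i j. i < n \<and> j < n \<and> (j = Suc i mod n \<or> i = Suc j mod n)}"
    using assms(1) unfolding cycle_graph_def by blast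
  define pos where "pos i = nat (i mod int n)" for i
  have pos: "pos i < n" "int (pos i) = i mod int n" for i
    using assms(2) by (auto simp: pos_def nat_less_iff)
  have inj: "f a = f c \<longleftrightarrow> a = c" if "a < n" "c < n" for a c
    using f that by (auto simp: bij_betw_def inj_on_def)
  have succ: "pos j = Suc (pos i) mod n \<longleftrightarrow> (j - i) mod int n = 1" for i j
  proof -
    have "pos j = Suc (pos i) mod n \<longleftrightarrow> int (pos j) = int (Suc (pos i) mod n)" by simp
    also have "\<dots> \<longleftrightarrow> j mod int n = (i + 1) mod int n"
      by (simp add: pos zmod_int mod_simps add.commute)
    also have "\<dots> \<longleftrightarrow> (j - i) mod int n = 1 mod int n"
      by (simp add: mod_eq_dvd_iff algebra_simps)
    finally show ?thesis using assms(2) by simp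
  qed
  have "cyclic_labelling C n (\<lambda>i. f (pos i))"
  proof
    show "f (pos i) = f (pos j) \<longleftrightarrow> (j - i) mod int n = 0" for i j
    proof -
      have "f (pos i) = f (pos j) \<longleftrightarrow> int (pos j) = int (pos i)"
        using inj[OF pos(1) pos(1), of i j] by auto
      also have "\<dots> \<longleftrightarrow> (j - i) mod int n = 0"
        by (simp only: pos mod_eq_dvd_iff dvd_eq_mod_eq_0)
      finally show ?thesis .
    qed
    have "range pos = {..<n}"
    proof
      show "{..<n} \<subseteq> range pos"
      proof
        fix a assume "a \<in> {..<n}"
        then have "a = pos (int a)" by (simp add: pos_def)
        then show "a \<in> range pos" by blast
      qed
    qed (use pos in auto)
    then have "range (\<lambda>i. f (pos i)) = f ` {..<n}" by (metis image_image)
    then show "range (\<lambda>i. f (pos i)) = pverts C" using f by (simp add: bij_betw_def)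
    show "parcs C \<subseteq> pverts C \<times> pverts C" unfolding arcs using f by (auto simp: bij_betw_def)
    show "(f (pos i), f (pos j)) \<in> parcs C \<longleftrightarrow> (j - i) mod int n = 1 \<or> (i - j) mod int n = 1" for i j
    proof -
      have "(f (pos i), f (pos j)) \<in> parcs C \<longleftrightarrow> pos j = Suc (pos i) mod n \<or> pos i = Suc (pos j) mod n"
        unfolding arcs using pos(1) inj by blast
      then show ?thesis unfolding succ .
    qed
  qed (rule assms(2))
  then show ?thesis by (rule that)
qed

lemma small_mod:
  fixes x N :: int
  assumes "- N < x" "x < N"
  shows "x mod N = (if 0 \<le> x then x else x + N)"
proof (cases "0 \<le> x")
  case False
  have "x mod N = (x + N) mod N" by simp
  also have "\<dots> = x + N" using False assms by (intro mod_pos_pos_trivial) auto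
  finally show ?thesis using False by simp
qed (use assms in simp)

context cyclic_labelling
begin

lemma labels_window: "bij_betw (\<lambda>t. g (i + t)) {0..<int n} (pverts C)"
proof (rule bij_betw_imageI)
  show "inj_on (\<lambda>t. g (i + t)) {0..<int n}"
  proof (rule inj_onI)
    fix s t assume *: "s \<in> {0..<int n}" "t \<in> {0..<int n}" "g (i + s) = g (i + t)"
    then have "(t - s) mod int n = 0" by (simp add: same)
    then show "s = t" using * by (subst (asm) small_mod) (auto split: if_splits)
  qed
  have "g j \<in> (\<lambda>t. g (i + t)) ` {0..<int n}" for j
  proof (rule image_eqI)
    show "g j = g (i + (j - i) mod int n)" 
      using mod_add_right_eq[of "i - j" "j - i" "int n"] by (simp add: same algebra_simps)
    show "(j - i) mod int n \<in> {0..<int n}" using long by simp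
  qed
  moreover have "g j \<in> pverts C" for j using range_g by blast
  ultimately show "(\<lambda>t. g (i + t)) ` {0..<int n} = pverts C" unfolding range_g[symmetric] by blast
qed

definition offset_dist :: "int \<Rightarrow> int \<Rightarrow> nat" where
  "offset_dist s t = (if t = s then 0 else if \<bar>t - s\<bar> \<in> {1, int n - 1} then 1 else 2)"

lemma adj_dist_offset:
  assumes "s \<in> {0..<int n}" "t \<in> {0..<int n}"
  shows "adj_dist C (g (i + s)) (g (i + t)) = offset_dist s t"
proof -
  have 1: "(t - s) mod int n = (if 0 \<le> t - s then t - s else t - s + int n)"
    and 2: "(s - t) mod int n = (if 0 \<le> s - t then s - t else s - t + int n)"
    by (rule small_mod; use assms in auto)+
  have "g (i + s) = g (i + t) \<longleftrightarrow> t = s"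
    using assms long unfolding same by (simp add: 1)
  moreover have "(g (i + s), g (i + t)) \<in> parcs C \<longleftrightarrow> \<bar>t - s\<bar> \<in> {1, int n - 1}"
    using assms long unfolding arc by (auto simp: 1 2)
  ultimately show ?thesis by (simp add: adj_dist_def offset_dist_def)
qed

text \<open>
  The indicator sequence of a vertex set, which translates generators into 0-1 sequences.
\<close>

definition trace :: "'b set \<Rightarrow> int \<Rightarrow> nat" where
  "trace S i = of_bool (g i \<in> S)"

lemma trace_period: "trace S (i + int n) = trace S i"
proof -
  have "g (i + int n) = g i" by (simp add: same)
  then show ?thesis by (simp add: trace_def)
qed

lemma trace_period_pred: "trace S (i + (int n - 1)) = trace S (i - 1)"
  using trace_period[of S "i - 1"] by (simp add: algebra_simps)

lemma card_labels:
  assumes "S \<subseteq> pverts C"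
  shows "card {z \<in> S. P z} = (\<Sum>t \<in> {t \<in> {0..<int n}. P (g (i + t))}. trace S (i + t))"
proof -
  let ?T = "{t \<in> {t \<in> {0..<int n}. P (g (i + t))}. g (i + t) \<in> S}"
  have inj: "inj_on (\<lambda>t. g (i + t)) {0..<int n}"
    and img: "(\<lambda>t. g (i + t)) ` {0..<int n} = pverts C"
    using labels_window[of i] by (auto simp: bij_betw_def)
  have "{z \<in> S. P z} = (\<lambda>t. g (i + t)) ` ?T"
  proof (intro set_eqI iffI)
    fix z assume z: "z \<in> {z \<in> S. P z}"
    then have "z \<in> (\<lambda>t. g (i + t)) ` {0..<int n}" using assms img by blast
    then show "z \<in> (\<lambda>t. g (i + t)) ` ?T" using z by blast
  qed auto
  then have "card {z \<in> S. P z} = card ?T"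
    by (simp only:) (rule card_image, rule inj_on_subset[OF inj], blast)
  also have "\<dots> = (\<Sum>t \<in> ?T. 1)" by simp
  also have "\<dots> = (\<Sum>t \<in> {t \<in> {0..<int n}. P (g (i + t))}. if g (i + t) \<in> S then 1 else 0)"
    by (rule sum.inter_filter, rule finite_subset[of _ "{0..<int n}"]) auto
  also have "\<dots> = (\<Sum>t \<in> {t \<in> {0..<int n}. P (g (i + t))}. trace S (i + t))"
    by (simp add: trace_def of_bool_def)
  finally show ?thesis .
qed

lemma card_trace:
  assumes "S \<subseteq> pverts C"
  shows "card S = weight n (trace S)"
proof -
  have "{z \<in> S. True} = S" "{t \<in> {0..<int n}. True} = {0..<int n}" by blast+
  then show ?thesis
    using card_labels[OF assms, of "\<lambda>_. True" 0] by (simp only: weight_def add_0)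
qed

definition separators :: "'b set \<Rightarrow> 'b \<Rightarrow> 'b \<Rightarrow> 'b set" where
  "separators S x y = {z \<in> S. adj_dist C x z \<noteq> adj_dist C y z}"

lemma separators_commute: "separators S x y = separators S y x"
  by (auto simp: separators_def)

lemma card_separators:
  assumes "S \<subseteq> pverts C" "d \<in> {0..<int n}"
  shows "card (separators S (g i) (g (i + d))) =
    (\<Sum>t \<in> {t \<in> {0..<int n}. offset_dist 0 t \<noteq> offset_dist d t}. trace S (i + t))"
proof -
  have "{t \<in> {0..<int n}. adj_dist C (g i) (g (i + t)) \<noteq> adj_dist C (g (i + d)) (g (i + t))} =
      {t \<in> {0..<int n}. offset_dist 0 t \<noteq> offset_dist d t}"
    using adj_dist_offset[of 0 _ i] adj_dist_offset[OF assms(2), of _ i] long by auto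
  then show ?thesis unfolding separators_def card_labels[OF assms(1), of _ i] by simp
qed

lemma offset_dist_small:
  assumes "t \<in> {0..<int n}"
  shows "offset_dist 0 t = (if t = 0 then 0 else if t = 1 \<or> t = int n - 1 then 1 else 2)"
    and "1 \<le> d \<Longrightarrow> d \<le> int n - 2 \<Longrightarrow>
      offset_dist d t = (if t = d then 0 else if t = d - 1 \<or> t = d + 1 then 1 else 2)"
proof -
  show "offset_dist 0 t = (if t = 0 then 0 else if t = 1 \<or> t = int n - 1 then 1 else 2)"
    using assms by (simp add: offset_dist_def)
  assume d: "1 \<le> d" "d \<le> int n - 2"
  have "\<bar>t - d\<bar> \<in> {1, int n - 1} \<longleftrightarrow> t = d - 1 \<or> t = d + 1"
    using assms d by (simp add: abs_if) arith
  then show "offset_dist d t = (if t = d then 0 else if t = d - 1 \<or> t = d + 1 then 1 else 2)"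
    unfolding offset_dist_def by simp
qed

text \<open>
  The closed neighbourhoods minus the common neighbours; the offset \<open>n - 1\<close> stands for -1.
\<close>

lemma differing_offsets:
  assumes "1 \<le> d" "d \<le> int n - 2"
  shows "{t \<in> {0..<int n}. offset_dist 0 t \<noteq> offset_dist d t} =
    {0, d} \<union> (({1, int n - 1} - {d - 1, d + 1}) \<union> ({d - 1, d + 1} - {1, int n - 1}))"
    (is "?L = ?R")
proof (rule set_eqI)
  fix t
  have in_range: "t \<in> {0..<int n}" if "t \<in> ?R" using that assms by auto
  have "offset_dist 0 t \<noteq> offset_dist d t \<longleftrightarrow> t \<in> ?R" if "t \<in> {0..<int n}"
    unfolding offset_dist_small(1)[OF that] offset_dist_small(2)[OF that assms]
    using assms by simp
  then show "t \<in> ?L \<longleftrightarrow> t \<in> ?R" using in_range by blast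
qed

lemma card_separators_1:
  assumes "S \<subseteq> pverts C"
  shows "card (separators S (g i) (g (i + 1))) =
    trace S (i - 1) + trace S i + trace S (i + 1) + trace S (i + 2)"
proof -
  have "{t \<in> {0..<int n}. offset_dist 0 t \<noteq> offset_dist 1 t} = {0, 1, 2, int n - 1}"
    using long by (subst differing_offsets) auto
  then show ?thesis
    using card_separators[OF assms, of 1 i] long trace_period_pred[of S i] by simp
qed

lemma card_separators_2:
  assumes "S \<subseteq> pverts C"
  shows "card (separators S (g i) (g (i + 2))) =
    trace S (i - 1) + trace S i + trace S (i + 2) + trace S (i + 3)"
proof -
  have "{t \<in> {0..<int n}. offset_dist 0 t \<noteq> offset_dist 2 t} = {0, 2, 3, int n - 1}"
    using long by (subst differing_offsets) auto
  then show ?thesis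
    using card_separators[OF assms, of 2 i] long trace_period_pred[of S i] by simp
qed

lemma card_separators_far:
  assumes "S \<subseteq> pverts C" "3 \<le> d" "d \<le> int n - 3"
  shows "card (separators S (g i) (g (i + d))) =
    trace S (i - 1) + trace S i + trace S (i + 1) +
    (trace S (i - 1 + d) + trace S (i + d) + trace S (i + 1 + d))"
proof -
  have "{t \<in> {0..<int n}. offset_dist 0 t \<noteq> offset_dist d t} =
      {0, 1, int n - 1, d - 1, d, d + 1}"
    using long assms(2,3) by (subst differing_offsets) auto
  moreover have "d \<in> {0..<int n}" using assms(2,3) by simp
  ultimately have "card (separators S (g i) (g (i + d))) =
      (\<Sum>t\<in>{0, 1, int n - 1, d - 1, d, d + 1}. trace S (i + t))"
    using card_separators[OF assms(1), of d i] by (simp only:)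
  also have "\<dots> = trace S i + trace S (i + 1) + trace S (i + (int n - 1)) +
      (trace S (i + (d - 1)) + trace S (i + d) + trace S (i + (d + 1)))"
    using long assms(2,3) by simp
  also have "i + (d - 1) = i - 1 + d" by simp
  also have "i + (d + 1) = i + 1 + d" by simp
  finally show ?thesis by (simp add: trace_period_pred)
qed

text \<open>
  An offset \<open>n - 1\<close> or \<open>n - 2\<close> becomes 1 or 2 when the two vertices change roles, so the offsets
  1, 2 and those from 3 to \<open>n - 3\<close> account for all pairs.
\<close>

lemma adjacency_generator_iff_trace:
  assumes S: "S \<subseteq> pverts C"
  shows "adjacency_generator k C S \<longleftrightarrow> cyclic_generator k n (trace S)"
proof
  assume gen: "adjacency_generator k C S"
  have sep: "k \<le> card (separators S (g i) (g (i + d)))" if "1 \<le> d" "d < int n" for i d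
  proof -
    have "g i \<noteq> g (i + d)" using that by (simp add: same)
    moreover have "g i \<in> pverts C" "g (i + d) \<in> pverts C" using range_g by blast+
    ultimately show ?thesis using gen unfolding adjacency_generator_def separators_def by blast
  qed
  show "cyclic_generator k n (trace S)" unfolding cyclic_generator_def
  proof (intro conjI allI impI)
    fix i
    show "trace S i \<le> 1" by (simp add: trace_def)
    show "trace S (i + int n) = trace S i" by (rule trace_period)
    show "k \<le> trace S i + trace S (i + 1) + trace S (i + 2) + trace S (i + 3)"
      using sep[of 1 "i + 1"] card_separators_1[OF S, of "i + 1"] long by (simp add: add.assoc)
    show "k \<le> trace S i + trace S (i + 1) + trace S (i + 3) + trace S (i + 4)"
      using sep[of 2 "i + 1"] card_separators_2[OF S, of "i + 1"] long by (simp add: add.assoc)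
    fix d :: int assume d: "3 \<le> d" "d \<le> int n - 3"
    have "i + 1 - 1 = i" "i + 1 + 1 = i + 2" "i + 1 + d = i + d + 1" "i + 2 + d = i + d + 2"
      by simp_all
    moreover have "k \<le> card (separators S (g (i + 1)) (g (i + 1 + d)))"
      using d by (intro sep) auto
    ultimately show "k \<le> trace S i + trace S (i + 1) + trace S (i + 2) +
        (trace S (i + d) + trace S (i + d + 1) + trace S (i + d + 2))"
      using card_separators_far[OF S d, of "i + 1"] by (simp only:)
  qed
next
  assume gen: "cyclic_generator k n (trace S)"
  have near: "k \<le> card (separators S (g i) (g (i + d)))" if "d \<in> {1..int n - 3}" for i d
  proof -
    consider "d = 1" | "d = 2" | "3 \<le> d" "d \<le> int n - 3" using \<open>d \<in> _\<close> by fastforce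
    then show ?thesis
    proof cases
      case 1
      then show ?thesis using generator_window[OF gen, of "i - 1"] card_separators_1[OF S, of i]
        by (simp add: algebra_simps)
    next
      case 2
      then show ?thesis using generator_gapped[OF gen, of "i - 1"] card_separators_2[OF S, of i]
        by (simp add: algebra_simps)
    next
      case 3
      have "i - 1 + 1 = i" "i - 1 + 2 = i + 1" "i - 1 + d + 1 = i + d" "i - 1 + d + 2 = i + 1 + d"
        by simp_all
      then show ?thesis using generator_far[OF gen 3, of "i - 1"] card_separators_far[OF S 3, of i]
        by (simp only:)
    qed
  qed
  have "k \<le> card (separators S x y)" if xy: "x \<in> pverts C" "y \<in> pverts C" "x \<noteq> y" for x y
  proof -
    obtain i where i: "x = g i" using xy(1) range_g by blast
    obtain d where d: "y = g (i + d)" "d \<in> {0..<int n}"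
      using xy(2) labels_window[of i] unfolding bij_betw_def by blast
    have "d \<noteq> 0" using xy(3) i d by auto
    show ?thesis
    proof (cases "d \<le> int n - 3")
      case True
      then show ?thesis using near[of d i] i d \<open>d \<noteq> 0\<close> by simp
    next
      case False
      have x: "g (i + d + (int n - d)) = x" unfolding i by (simp add: same)
      have "k \<le> card (separators S y (g (i + d + (int n - d))))"
        unfolding d(1) using False d(2) long by (intro near) auto
      then show ?thesis unfolding x by (simp only: separators_commute[of S x y])
    qed
  qed
  then show "adjacency_generator k C S"
    using S unfolding adjacency_generator_def separators_def by blast
qed

text \<open>
  Periodicity makes the value of the sequence depend on the vertex alone and not on its label.
\<close>

lemma trace_surj:
  assumes "cyclic_generator k n b"
  shows "\<exists>S \<subseteq> pverts C. trace S = b"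
proof (intro exI[of _ "g ` {i. b i = 1}"] conjI ext)
  show "g ` {i. b i = 1} \<subseteq> pverts C" using range_g by blast
  fix i
  have period_mult: "b (i + int m * int n) = b i" for i m
  proof (induction m)
    case (Suc m)
    then show ?case using generator_period[OF assms, of "i + int m * int n"] by (simp add: algebra_simps)
  qed simp
  have same_bit: "b i = b j" if "g i = g j" for i j
  proof -
    have "int n dvd j - i" using that by (simp add: same dvd_eq_mod_eq_0)
    then obtain c where "j - i = int n * c" by (rule dvdE)
    then have c: "j = i + c * int n" by (simp add: algebra_simps)
    show ?thesis
    proof (cases "0 \<le> c")
      case True
      then show ?thesis using period_mult[of i "nat c"] c by simp
    next
      case False
      then have "i = j + int (nat (- c)) * int n" using c by simp
      then show ?thesis using period_mult[of j "nat (- c)"] by simp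
    qed
  qed
  have "g i \<in> g ` {i. b i = 1} \<longleftrightarrow> b i = 1"
  proof
    assume "g i \<in> g ` {i. b i = 1}"
    then obtain j where "g i = g j" "b j = 1" by blast
    then show "b i = 1" using same_bit[of i j] by simp
  qed blast
  then show "trace (g ` {i. b i = 1}) i = b i"
    using generator_bit[OF assms, of i] by (cases "b i = 1") (auto simp: trace_def)
qed

lemma has_adjacency_dim_cycle:
  assumes "\<exists>b. cyclic_generator k n b \<and> weight n b = m"
    and "\<And>b. cyclic_generator k n b \<Longrightarrow> m \<le> weight n b"
  shows "has_adjacency_dim k C m"
proof -
  obtain b where b: "cyclic_generator k n b" "weight n b = m" using assms(1) by blast
  obtain S where S: "S \<subseteq> pverts C" "trace S = b" using trace_surj[OF b(1)] by blast
  have "adjacency_generator k C S" "card S = m"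
    unfolding adjacency_generator_iff_trace[OF S(1)] card_trace[OF S(1)] S(2) by (fact b)+
  moreover have "m \<le> card U" if U: "adjacency_generator k C U" for U
  proof -
    have sub: "U \<subseteq> pverts C" using U by (simp add: adjacency_generator_def)
    show ?thesis
      using assms(2) U unfolding adjacency_generator_iff_trace[OF sub] card_trace[OF sub] .
  qed
  ultimately show ?thesis unfolding has_adjacency_dim_def by blast
qed

lemma finite_labels: "finite (pverts C)"
  using labels_window[of 0] bij_betw_finite by blast

lemma neighbours:
  assumes "x \<in> pverts C"
  shows "finite {y. (x, y) \<in> parcs C}" "card {y. (x, y) \<in> parcs C} \<le> 2"
proof -
  obtain i where i: "x = g i" using assms range_g by blast
  have "{y. (x, y) \<in> parcs C} \<subseteq> {g (i + 1), g (i - 1)}"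
  proof
    fix y assume "y \<in> {y. (x, y) \<in> parcs C}"
    then have y: "(x, y) \<in> parcs C" by simp
    then obtain j where j: "y = g j" using arc_ends range_g by blast
    have "g (i + 1) = g j" if "(j - i) mod int n = 1"
    proof -
      have "(j - (i + 1)) mod int n = ((j - i) mod int n - 1) mod int n"
        by (simp add: mod_diff_left_eq diff_diff_add)
      then show ?thesis unfolding same that by simp
    qed
    moreover have "g j = g (i - 1)" if "(i - j) mod int n = 1"
    proof -
      have "(i - 1 - j) mod int n = ((i - j) mod int n - 1) mod int n"
        by (simp add: mod_diff_left_eq diff_diff_add add.commute)
      then show ?thesis unfolding same that by simp
    qed
    ultimately show "y \<in> {g (i + 1), g (i - 1)}" using y unfolding i j arc
      by (elim disjE) (simp_all only: insert_iff simp_thms)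
  qed
  moreover have "card {g (i + 1), g (i - 1)} \<le> 2" by (simp add: card_insert_if)
  ultimately show "finite {y. (x, y) \<in> parcs C}" "card {y. (x, y) \<in> parcs C} \<le> 2"
    by (meson card_mono finite.emptyI finite.insertI finite_subset le_trans)+
qed

end

lemma cycle_adjacency_dims:
  assumes "cycle_graph n C" "7 \<le> n"
  shows "has_adjacency_dim 1 C ((2 * n + 2) div 5)"
    and "has_adjacency_dim 2 C (nat \<lceil>real n / 2\<rceil>)"
    and "has_adjacency_dim 3 C (n - n div 5)"
    and "has_adjacency_dim 4 C n"
proof -
  obtain g where g: "cyclic_labelling C n g" using cycle_graph_labelling assms by blast
  note dim = cyclic_labelling.has_adjacency_dim_cycle[OF g]
  have half: "nat \<lceil>real n / 2\<rceil> = (n + 1) div 2" by linarith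
  show "has_adjacency_dim 1 C ((2 * n + 2) div 5)"
    by (rule dim[OF exists_generator_1[OF assms(2)]]) (drule weight_ge_1, simp_all)
  show "has_adjacency_dim 2 C (nat \<lceil>real n / 2\<rceil>)" unfolding half
    by (rule dim[OF exists_generator_2[OF assms(2)]]) (drule weight_ge_2, simp_all)
  show "has_adjacency_dim 3 C (n - n div 5)"
    by (rule dim[OF exists_generator_3[OF assms(2)]]) (drule weight_ge_3, simp_all)
  show "has_adjacency_dim 4 C n"
    by (rule dim[OF exists_generator_4]) (drule weight_ge_4, simp_all)
qed

section \<open>Coronas of cycles\<close>

lemma cycle_graph_degree_two:
  assumes "cycle_graph n C" "7 \<le> n"
  shows "finite (pverts C)" "parcs C \<subseteq> pverts C \<times> pverts C"
    and "x \<in> pverts C \<Longrightarrow> finite {y. (x, y) \<in> parcs C}"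
    and "x \<in> pverts C \<Longrightarrow> card {y. (x, y) \<in> parcs C} \<le> 2"
proof -
  obtain g where g: "cyclic_labelling C n g" using cycle_graph_labelling assms by blast
  show "finite (pverts C)" by (rule cyclic_labelling.finite_labels[OF g])
  show "parcs C \<subseteq> pverts C \<times> pverts C" by (rule cyclic_labelling.arc_ends[OF g])
  show "x \<in> pverts C \<Longrightarrow> finite {y. (x, y) \<in> parcs C}"
    by (rule cyclic_labelling.neighbours(1)[OF g])
  show "x \<in> pverts C \<Longrightarrow> card {y. (x, y) \<in> parcs C} \<le> 2"
    by (rule cyclic_labelling.neighbours(2)[OF g])
qed

text \<open>
  The slack of 2 is the vertex degree in a cycle: the neighbours of a vertex do not separate it from
  the new vertex of the join.
\<close>

lemma kmetric_dim_corona_cycles: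
  fixes G :: "'a pair_pre_digraph" and C :: "'a \<Rightarrow> 'b pair_pre_digraph"
  assumes G: "pair_graph G" "Digraph_Component.connected (with_proj G)" "2 \<le> card (pverts G)"
    and C: "\<And>v. v \<in> pverts G \<Longrightarrow> cycle_graph (n v) (C v)"
    and n: "\<And>v. v \<in> pverts G \<Longrightarrow> 7 \<le> n v"
    and dim: "\<And>v. v \<in> pverts G \<Longrightarrow> has_adjacency_dim k (C v) (m v)"
    and large: "\<And>v. v \<in> pverts G \<Longrightarrow> k + 2 \<le> m v"
  shows "kmetric_dim k (corona G C) = enat (\<Sum>v\<in>pverts G. m v)"
    and "kmetric_dim k (corona G (\<lambda>v. complement_graph (C v))) = enat (\<Sum>v\<in>pverts G. m v)"
    and "kmetric_dim k (corona G (\<lambda>v. K1_join (C v))) = enat (\<Sum>v\<in>pverts G. m v)"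
proof -
  note cyc = cycle_graph_degree_two[OF C n]
  have large': "k \<le> m v" if "v \<in> pverts G" for v using large[OF that] by simp
  have "corona_product G C"
    using G(1,2) cyc(1,2) by (intro corona_product.intro)
  then show "kmetric_dim k (corona G C) = enat (\<Sum>v\<in>pverts G. m v)"
    by (rule corona_product.kmetric_dim_corona[OF _ G(3) dim large'])
  have "corona_product G (\<lambda>v. complement_graph (C v))"
  proof (rule corona_product.intro[OF G(1,2)])
    fix v assume "v \<in> pverts G"
    then show "finite (pverts (complement_graph (C v)))" using cyc(1) by (simp add: complement_graph_def)
  qed (auto simp: complement_graph_def)
  moreover have "has_adjacency_dim k (complement_graph (C v)) (m v)" if "v \<in> pverts G" for v
    using dim[OF that] unfolding has_adjacency_dim_def adjacency_generator_complement .
  ultimately show "kmetric_dim k (corona G (\<lambda>v. complement_graph (C v))) = enat (\<Sum>v\<in>pverts G. m v)"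
    by (rule corona_product.kmetric_dim_corona[OF _ G(3) _ large'])
  have "corona_product G (\<lambda>v. K1_join (C v))"
  proof (rule corona_product.intro[OF G(1,2)])
    fix v assume v: "v \<in> pverts G"
    show "finite (pverts (K1_join (C v)))" using cyc(1)[OF v v] by (simp add: K1_join_def)
    show "parcs (K1_join (C v)) \<subseteq> pverts (K1_join (C v)) \<times> pverts (K1_join (C v))"
      using cyc(2)[OF v v] by (auto simp: K1_join_def)
  qed
  moreover have "has_adjacency_dim k (K1_join (C v)) (m v)" if v: "v \<in> pverts G" for v
    using cyc(1)[OF v v] cyc(4)[OF v v] cyc(3)[OF v v] dim[OF v] large[OF v]
    by (rule has_adjacency_dim_K1_join)
  ultimately show "kmetric_dim k (corona G (\<lambda>v. K1_join (C v))) = enat (\<Sum>v\<in>pverts G. m v)"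
    by (rule corona_product.kmetric_dim_corona[OF _ G(3) _ large'])
qed

theorem proposition44:
  fixes G :: "'a pair_pre_digraph"
    and C :: "'a \<Rightarrow> 'b pair_pre_digraph"
    and n :: "'a \<Rightarrow> nat"
  assumes "pair_graph G"
    and "Digraph_Component.connected (with_proj G)"
    and "2 \<le> card (pverts G)"
    and "\<And>v. v \<in> pverts G \<Longrightarrow> cycle_graph (n v) (C v)"
    and "\<And>v. v \<in> pverts G \<Longrightarrow> 7 \<le> n v"
  shows "
     (kmetric_dim 1 (corona G C) = kmetric_dim 1 (corona G (\<lambda>v. complement_graph (C v))) \<and>
      kmetric_dim 1 (corona G (\<lambda>v. complement_graph (C v))) = kmetric_dim 1 (corona G (\<lambda>v. K1_join (C v))) \<and>
      kmetric_dim 1 (corona G (\<lambda>v. K1_join (C v))) = enat (\<Sum>v\<in>pverts G. (2 * n v + 2) div 5)) \<and>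
     (kmetric_dim 2 (corona G C) = kmetric_dim 2 (corona G (\<lambda>v. complement_graph (C v))) \<and>
      kmetric_dim 2 (corona G (\<lambda>v. complement_graph (C v))) = kmetric_dim 2 (corona G (\<lambda>v. K1_join (C v))) \<and>
      kmetric_dim 2 (corona G (\<lambda>v. K1_join (C v))) = enat (\<Sum>v\<in>pverts G. nat \<lceil>real (n v) / 2\<rceil>)) \<and>
     (kmetric_dim 3 (corona G C) = kmetric_dim 3 (corona G (\<lambda>v. complement_graph (C v))) \<and>
      kmetric_dim 3 (corona G (\<lambda>v. complement_graph (C v))) = kmetric_dim 3 (corona G (\<lambda>v. K1_join (C v))) \<and>
      kmetric_dim 3 (corona G (\<lambda>v. K1_join (C v))) = enat (\<Sum>v\<in>pverts G. n v - n v div 5)) \<and>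
     (kmetric_dim 4 (corona G C) = kmetric_dim 4 (corona G (\<lambda>v. complement_graph (C v))) \<and>
      kmetric_dim 4 (corona G (\<lambda>v. complement_graph (C v))) = kmetric_dim 4 (corona G (\<lambda>v. K1_join (C v))) \<and>
      kmetric_dim 4 (corona G (\<lambda>v. K1_join (C v))) = enat (\<Sum>v\<in>pverts G. n v))"
proof -
  have dims: "kmetric_dim k (corona G C) = kmetric_dim k (corona G (\<lambda>v. complement_graph (C v))) \<and>
      kmetric_dim k (corona G (\<lambda>v. complement_graph (C v))) = kmetric_dim k (corona G (\<lambda>v. K1_join (C v))) \<and>
      kmetric_dim k (corona G (\<lambda>v. K1_join (C v))) = enat (\<Sum>v\<in>pverts G. m v)"
    if "\<And>v. v \<in> pverts G \<Longrightarrow> has_adjacency_dim k (C v) (m v) \<and> k + 2 \<le> m v" for k m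
  proof -
    have dim: "\<And>v. v \<in> pverts G \<Longrightarrow> has_adjacency_dim k (C v) (m v)"
      and large: "\<And>v. v \<in> pverts G \<Longrightarrow> k + 2 \<le> m v" using that by simp_all
    have "kmetric_dim k (corona G C) = enat (\<Sum>v\<in>pverts G. m v)"
      using assms dim large by (rule kmetric_dim_corona_cycles(1))
    moreover have "kmetric_dim k (corona G (\<lambda>v. complement_graph (C v))) = enat (\<Sum>v\<in>pverts G. m v)"
      using assms dim large by (rule kmetric_dim_corona_cycles(2))
    moreover have "kmetric_dim k (corona G (\<lambda>v. K1_join (C v))) = enat (\<Sum>v\<in>pverts G. m v)"
      using assms dim large by (rule kmetric_dim_corona_cycles(3))
    ultimately show ?thesis by (simp only: simp_thms)
  qed
  show ?thesis
  proof (intro conjI[OF dims conjI[OF dims conjI[OF dims dims]]])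
    fix v assume "v \<in> pverts G"
    note cycle = cycle_adjacency_dims[OF assms(4,5)[OF this]] and long = assms(5)[OF this]
    show "has_adjacency_dim 1 (C v) ((2 * n v + 2) div 5) \<and> 1 + 2 \<le> (2 * n v + 2) div 5"
      by (rule conjI[OF cycle(1)]) (use long in linarith)
    show "has_adjacency_dim 2 (C v) (nat \<lceil>real (n v) / 2\<rceil>) \<and> 2 + 2 \<le> nat \<lceil>real (n v) / 2\<rceil>"
      by (rule conjI[OF cycle(2)]) (use long in linarith)
    show "has_adjacency_dim 3 (C v) (n v - n v div 5) \<and> 3 + 2 \<le> n v - n v div 5"
      by (rule conjI[OF cycle(3)]) (use long in linarith)
    show "has_adjacency_dim 4 (C v) (n v) \<and> 4 + 2 \<le> n v"
      by (rule conjI[OF cycle(4)]) (use long in linarith)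
  qed
qed

end
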